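(* Let $\mathcal{M} = (M, G, \triangleright)$ be a right amenable and finitely right generated left homogeneous space with finite stabilisers and let $Q$ be a finite set. For each coordinate system $\mathcal{K}$ for $\mathcal{M}$ and each $\mathcal{K}$-big subgroup $H$ of $G$, each strongly irreducible subshift of $Q^M$ of finite type with respect to $\mathcal{R} = (\mathcal{M}, \mathcal{K})$ and $H$ has the Moore property and the Myhill property with respect to $\mathcal{R}$ and $H$.
   Context: A left homogeneous space is a triple $\mathcal{M}=(M,G,\triangleright)$ where the group $G$ acts transitively from the left on the non-empty set $M$ by $(g,m)\mapsto g\triangleright m$. A coordinate system for $\mathcal{M}$ is a tuple $\mathcal{K}=(m_0,(g_{m_0,m})_{m\in M})$ with $m_0\in M$, $g_{m_0,m}\in G$ and $g_{m_0,m}\triangleright m_0=m$ for all $m\in M$; $\mathcal{R}=(\mathcal{M},\mathcal{K})$ is a cell space. Write $G_0$ for the stabiliser of $m_0$. The right semi-action of $G/G_0$ on $M$ is $m\triangleleft gG_0=g_{m_0,m}g\triangleright m_0$. Identify $M$ with $G/G_0$ via $m\mapsto\{g\in G: g\triangleright m_0=m\}$; then $m\triangleleft n=g_{m_0,m}\triangleright n$ for $m,n\in M$. A subgroup $H$ of $G$ is $\mathcal{K}$-big if it contains all $g_{m_0,m}$, $m\in M$; put $H_0=H\cap G_0$. $\mathcal{M}$ is right amenable if for some coordinate system $\mathcal{K}$ there is a finitely additive probability measure $\mu$ on all subsets of $M$ such that $\mu(A\triangleleft\mathfrak{g})=\mu(A)$ for all $\mathfrak{g}\in G/G_0$ and all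 $A\subseteq M$ on which $m\mapsto m\triangleleft\mathfrak{g}$ is injective, where $A\triangleleft\mathfrak{g}=\{a\triangleleft\mathfrak{g}:a\in A\}$. (With finite stabilisers, this holds for one coordinate system if and only if it holds for each one.) $\mathcal{M}$ is finitely right generated if for some coordinate system $\mathcal{K}$ there is a finite $S\subseteq G/G_0$ with $G_0\cdot S\subseteq S$ such that each $m\in M$ has the form $(((m_0\triangleleft s_1)\triangleleft s_2)\cdots)\triangleleft s_k$ with $k\ge 0$ and $s_i\in S\cup S^{-1}$, where $S^{-1}=\{g^{-1}G_0:s\in S,g\in s\}$; such $S$ is a right generating set of $(\mathcal{M},\mathcal{K})$, symmetric if $S^{-1}\subseteq S$. (Finite right generation for one coordinate system implies it for each one.) For given $\mathcal{K}$ and $H$, choose a finite symmetric right generating set $S$ of $\mathcal{R}=(\mathcal{M},\mathcal{K})$; the notions of subshift, finite type, strong irreducibility, locality, and the Moore and Myhill properties below do not depend on this choice. Let $d$ be the path metric on $M$ of the graph with an edge from $m$ to $m\triangleleft s$ for $m\in M$, $s\in S$; $\mathbb{B}(\rho)=\{m\in M:d(m_0,m)\le\rho\}$; $d(A,B)=\inf\{d(a,b):a\in A,b\in B\}$ (with $\inf\emptyset=\infty$). For $A\subseteq M$, an $A$-pattern is a map $p\colon A\to Q$, $\mathrm{dom}(p)=A$; it is finite if $A$ is. For $g\in G$, $g\blacktriangleright p\colon g\triangleright A\to Q$, $m\mapsto p(g^{-1}\triangleright m)$. An $A$-pattern $p$ semi-occurs in an $A'$-pattern $p'$ if there is $h\in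 H$ with $h\triangleright A\subseteq A'$ and $h\blacktriangleright p=p'|_{h\triangleright A}$. For a set $\mathfrak{F}$ of finite patterns, $\langle\mathfrak{F}\rangle$ is the set of $c\in Q^M$ in which no $\mathfrak{f}\in\mathfrak{F}$ semi-occurs. $X\subseteq Q^M$ is a subshift if $X=\langle\mathfrak{F}\rangle$ for some set $\mathfrak{F}$ of finite patterns, of finite type if $\mathfrak{F}$ can be chosen finite. A pattern is allowed in $X$ if it semi-occurs in some $x\in X$; $X_A=\{x|_A:x\in X\}$. A subshift $X$ is strongly irreducible if there is $\kappa\in\mathbb{N}_0$ such that for all finite patterns $p,p'$ allowed in $X$ with $d(\mathrm{dom}(p),\mathrm{dom}(p'))\ge\kappa+1$ there is $x\in X$ with $x|_{\mathrm{dom}(p)}=p$ and $x|_{\mathrm{dom}(p')}=p'$. For subshifts $X,Y$, a map $\Delta\colon X\to Y$ is local if there are $\kappa\in\mathbb{N}_0$, $N\subseteq\mathbb{B}(\kappa)$ with $G_0\triangleright N\subseteq N$, and $\delta\colon X_N\to Q$ with $\delta(h_0\blacktriangleright\ell)=\delta(\ell)$ for all $h_0\in H_0$, $\ell\in X_N$, such that $\Delta(x)(m)=\delta(n\mapsto x(m\triangleleft n))$ for all $x\in X$, $m\in M$. $\Delta$ is pre-injective if for all $x,x'\in X$ with $\{m:x(m)\ne x'(m)\}$ finite and $\Delta(x)=\Delta(x')$ one has $x=x'$. $X$ has the Moore property if each surjective local map $X\to X$ is pre-injective, and the Myhill property if each pre-injective local map $X\to X$ is surjective. *)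

theory Defs
  imports "HOL-Algebra.Group_Action" "HOL-Algebra.Left_Coset" "HOL-Analysis.Measure_Space" "HOL-Library.Extended_Nat"
begin

section \<open>Left homogeneous spaces and coordinate systems\<close>

text \<open>
  A left action of \<open>G\<close> on \<open>M\<close> is a homomorphism \<open>\<phi>\<close> from \<open>G\<close> to the group of
  bijections of \<open>M\<close>; \<open>\<phi> g m\<close> is the action of \<open>g\<close> on \<open>m\<close>.
\<close>

locale left_homogeneous_space = transitive_action G M \<phi>
  for G :: "('g, 'z) monoid_scheme" (structure) and M :: "'m set" and \<phi> :: "'g \<Rightarrow> 'm \<Rightarrow> 'm" +
  assumes nonempty: "M \<noteq> {}"

definition finite_stabilisers ::
  "('g, 'z) monoid_scheme \<Rightarrow> 'm set \<Rightarrow> ('g \<Rightarrow> 'm \<Rightarrow> 'm) \<Rightarrow> bool" where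
  "finite_stabilisers G M \<phi> \<longleftrightarrow> (\<forall>m\<in>M. finite (stabilizer G \<phi> m))"

text \<open>A coordinate system is a pair of the point \<open>m\<^sub>0\<close> and the family \<open>m \<mapsto> g\<^bsub>m\<^sub>0,m\<^esub>\<close>.\<close>

type_synonym ('g, 'm) coords = "'m \<times> ('m \<Rightarrow> 'g)"

abbreviation origin :: "('g, 'm) coords \<Rightarrow> 'm" where
  "origin K \<equiv> fst K"

abbreviation coord :: "('g, 'm) coords \<Rightarrow> 'm \<Rightarrow> 'g" where
  "coord K \<equiv> snd K"

definition coordinate_system ::
  "('g, 'z) monoid_scheme \<Rightarrow> 'm set \<Rightarrow> ('g \<Rightarrow> 'm \<Rightarrow> 'm) \<Rightarrow> ('g, 'm) coords \<Rightarrow> bool" where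
  "coordinate_system G M \<phi> K \<longleftrightarrow>
     origin K \<in> M \<and> (\<forall>m\<in>M. coord K m \<in> carrier G \<and> \<phi> (coord K m) (origin K) = m)"

abbreviation origin_stabiliser ::
  "('g, 'z) monoid_scheme \<Rightarrow> ('g \<Rightarrow> 'm \<Rightarrow> 'm) \<Rightarrow> ('g, 'm) coords \<Rightarrow> 'g set" where
  "origin_stabiliser G \<phi> K \<equiv> stabilizer G \<phi> (origin K)"

definition big_subgroup ::
  "('g, 'z) monoid_scheme \<Rightarrow> 'm set \<Rightarrow> ('g, 'm) coords \<Rightarrow> 'g set \<Rightarrow> bool" where
  "big_subgroup G M K H \<longleftrightarrow> subgroup H G \<and> (\<forall>m\<in>M. coord K m \<in> H)"

text \<open>
  The right semi-action of a left coset of the stabiliser of \<open>m\<^sub>0\<close>; by \<open>semi_act_eq\<close> below the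
  value does not depend on the chosen representative.
\<close>

definition semi_act ::
  "('g, 'z) monoid_scheme \<Rightarrow> ('g \<Rightarrow> 'm \<Rightarrow> 'm) \<Rightarrow> ('g, 'm) coords \<Rightarrow> 'm \<Rightarrow> 'g set \<Rightarrow> 'm" where
  "semi_act G \<phi> K m \<gamma> = \<phi> (coord K m \<otimes>\<^bsub>G\<^esub> (SOME g. g \<in> \<gamma>)) (origin K)"

text \<open>The identification of a point \<open>n\<close> with a left coset, and the resulting \<open>m \<triangleleft> n\<close>.\<close>

definition point_coset ::
  "('g, 'z) monoid_scheme \<Rightarrow> ('g \<Rightarrow> 'm \<Rightarrow> 'm) \<Rightarrow> ('g, 'm) coords \<Rightarrow> 'm \<Rightarrow> 'g set" where
  "point_coset G \<phi> K n = {g \<in> carrier G. \<phi> g (origin K) = n}"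

definition semi_act_point ::
  "('g, 'z) monoid_scheme \<Rightarrow> ('g \<Rightarrow> 'm \<Rightarrow> 'm) \<Rightarrow> ('g, 'm) coords \<Rightarrow> 'm \<Rightarrow> 'm \<Rightarrow> 'm" where
  "semi_act_point G \<phi> K m n = semi_act G \<phi> K m (point_coset G \<phi> K n)"

lemma (in left_homogeneous_space) semi_act_eq:
  assumes K: "coordinate_system G M \<phi> K" and m: "m \<in> M" and g: "g \<in> carrier G"
  shows "semi_act G \<phi> K m (g <# origin_stabiliser G \<phi> K) = \<phi> (coord K m \<otimes> g) (origin K)"
proof -
  interpret group G using group_hom group_hom.axioms(1) by blast
  let ?G\<^sub>0 = "origin_stabiliser G \<phi> K"
  have o: "origin K \<in> M" and k: "coord K m \<in> carrier G"
    using K m by (auto simp: coordinate_system_def)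
  have "g <# ?G\<^sub>0 \<noteq> {}"
    using stabilizer_one_closed[OF o] by (auto simp: l_coset_def)
  then have "(SOME x. x \<in> g <# ?G\<^sub>0) \<in> g <# ?G\<^sub>0"
    by (simp add: some_in_eq)
  then obtain h where h: "h \<in> ?G\<^sub>0" and x: "(SOME x. x \<in> g <# ?G\<^sub>0) = g \<otimes> h"
    by (auto simp: l_coset_def)
  have hc: "h \<in> carrier G" and ho: "\<phi> h (origin K) = origin K"
    using h by (auto simp: stabilizer_def)
  have "\<phi> (coord K m \<otimes> (g \<otimes> h)) (origin K) = \<phi> (coord K m \<otimes> g \<otimes> h) (origin K)"
    using k g hc by (simp add: m_assoc)
  also have "\<dots> = \<phi> (coord K m \<otimes> g) (origin K)"
    using composition_rule[OF o m_closed[OF k g] hc] ho by simp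
  finally show ?thesis
    by (simp add: semi_act_def x)
qed

lemma (in left_homogeneous_space) semi_act_point_eq:
  assumes K: "coordinate_system G M \<phi> K" and m: "m \<in> M" and n: "n \<in> M"
  shows "semi_act_point G \<phi> K m n = \<phi> (coord K m) n"
proof -
  have o: "origin K \<in> M" and k: "coord K m \<in> carrier G"
    and kn: "coord K n \<in> point_coset G \<phi> K n"
    using K m n by (auto simp: coordinate_system_def point_coset_def)
  have "(SOME g. g \<in> point_coset G \<phi> K n) \<in> point_coset G \<phi> K n"
    using kn by (rule someI)
  then show ?thesis
    using composition_rule[OF o k]
    by (simp add: semi_act_point_def semi_act_def point_coset_def)
qed


section \<open>Right amenability and finite right generation\<close>

definition right_amenable ::
  "('g, 'z) monoid_scheme \<Rightarrow> 'm set \<Rightarrow> ('g \<Rightarrow> 'm \<Rightarrow> 'm) \<Rightarrow> bool" where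
  "right_amenable G M \<phi> \<longleftrightarrow>
     (\<exists>K (\<mu> :: 'm set \<Rightarrow> real). coordinate_system G M \<phi> K \<and>
        (\<forall>A. A \<subseteq> M \<longrightarrow> 0 \<le> \<mu> A) \<and> \<mu> M = 1 \<and> additive (Pow M) \<mu> \<and>
        (\<forall>\<gamma> \<in> lcosets\<^bsub>G\<^esub> (origin_stabiliser G \<phi> K). \<forall>A. A \<subseteq> M \<longrightarrow>
           inj_on (\<lambda>m. semi_act G \<phi> K m \<gamma>) A \<longrightarrow> \<mu> ((\<lambda>m. semi_act G \<phi> K m \<gamma>) ` A) = \<mu> A))"

definition coset_inverses ::
  "('g, 'z) monoid_scheme \<Rightarrow> ('g \<Rightarrow> 'm \<Rightarrow> 'm) \<Rightarrow> ('g, 'm) coords \<Rightarrow> 'g set set \<Rightarrow> 'g set set" where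
  "coset_inverses G \<phi> K S = {inv\<^bsub>G\<^esub> g <#\<^bsub>G\<^esub> origin_stabiliser G \<phi> K | g s. s \<in> S \<and> g \<in> s}"

definition right_generating_set ::
  "('g, 'z) monoid_scheme \<Rightarrow> 'm set \<Rightarrow> ('g \<Rightarrow> 'm \<Rightarrow> 'm) \<Rightarrow> ('g, 'm) coords \<Rightarrow> 'g set set \<Rightarrow> bool"
  where
  "right_generating_set G M \<phi> K S \<longleftrightarrow>
     S \<subseteq> lcosets\<^bsub>G\<^esub> (origin_stabiliser G \<phi> K) \<and>
     (\<forall>g \<in> origin_stabiliser G \<phi> K. \<forall>s\<in>S. g <#\<^bsub>G\<^esub> s \<in> S) \<and>
     (\<forall>m\<in>M. \<exists>ss. set ss \<subseteq> S \<union> coset_inverses G \<phi> K S \<and> m = foldl (semi_act G \<phi> K) (origin K) ss)"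

definition symmetric_generators ::
  "('g, 'z) monoid_scheme \<Rightarrow> ('g \<Rightarrow> 'm \<Rightarrow> 'm) \<Rightarrow> ('g, 'm) coords \<Rightarrow> 'g set set \<Rightarrow> bool" where
  "symmetric_generators G \<phi> K S \<longleftrightarrow> coset_inverses G \<phi> K S \<subseteq> S"

definition finitely_right_generated ::
  "('g, 'z) monoid_scheme \<Rightarrow> 'm set \<Rightarrow> ('g \<Rightarrow> 'm \<Rightarrow> 'm) \<Rightarrow> bool" where
  "finitely_right_generated G M \<phi> \<longleftrightarrow>
     (\<exists>K S. coordinate_system G M \<phi> K \<and> finite S \<and> right_generating_set G M \<phi> K S)"


section \<open>The metric of the Cayley graph\<close>

definition cayley_edges ::
  "('g, 'z) monoid_scheme \<Rightarrow> 'm set \<Rightarrow> ('g \<Rightarrow> 'm \<Rightarrow> 'm) \<Rightarrow> ('g, 'm) coords \<Rightarrow> 'g set set \<Rightarrow> ('m \<times> 'm) set"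
  where
  "cayley_edges G M \<phi> K S = {(m, semi_act G \<phi> K m s) | m s. m \<in> M \<and> s \<in> S}"

text \<open>
  The least length of a path. The edge relation is symmetric for symmetric \<open>S\<close>, so directed
  paths suffice.
\<close>

definition path_dist ::
  "('g, 'z) monoid_scheme \<Rightarrow> 'm set \<Rightarrow> ('g \<Rightarrow> 'm \<Rightarrow> 'm) \<Rightarrow> ('g, 'm) coords \<Rightarrow> 'g set set \<Rightarrow>
   'm \<Rightarrow> 'm \<Rightarrow> enat" where
  "path_dist G M \<phi> K S m m' = (INF l \<in> {l. (m, m') \<in> cayley_edges G M \<phi> K S ^^ l}. enat l)"

definition path_ball ::
  "('g, 'z) monoid_scheme \<Rightarrow> 'm set \<Rightarrow> ('g \<Rightarrow> 'm \<Rightarrow> 'm) \<Rightarrow> ('g, 'm) coords \<Rightarrow> 'g set set \<Rightarrow>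
   nat \<Rightarrow> 'm set" where
  "path_ball G M \<phi> K S \<rho> = {m \<in> M. path_dist G M \<phi> K S (origin K) m \<le> enat \<rho>}"

definition path_setdist ::
  "('g, 'z) monoid_scheme \<Rightarrow> 'm set \<Rightarrow> ('g \<Rightarrow> 'm \<Rightarrow> 'm) \<Rightarrow> ('g, 'm) coords \<Rightarrow> 'g set set \<Rightarrow>
   'm set \<Rightarrow> 'm set \<Rightarrow> enat" where
  "path_setdist G M \<phi> K S A B = (INF a\<in>A. INF b\<in>B. path_dist G M \<phi> K S a b)"


section \<open>Patterns and subshifts\<close>

text \<open>
  An \<open>A\<close>-pattern is a partial map with domain \<open>A\<close> and values in \<open>Q\<close>; the elements of \<open>Q\<^sup>M\<close>
  are the \<open>M\<close>-patterns.
\<close>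

definition patterns :: "'q set \<Rightarrow> 'm set \<Rightarrow> ('m \<rightharpoonup> 'q) set" where
  "patterns Q A = {p. dom p = A \<and> ran p \<subseteq> Q}"

definition finite_patterns :: "'q set \<Rightarrow> 'm set \<Rightarrow> ('m \<rightharpoonup> 'q) set" where
  "finite_patterns Q M = (\<Union>A \<in> {A. A \<subseteq> M \<and> finite A}. patterns Q A)"

definition translate ::
  "('g, 'z) monoid_scheme \<Rightarrow> 'm set \<Rightarrow> ('g \<Rightarrow> 'm \<Rightarrow> 'm) \<Rightarrow> 'g \<Rightarrow> ('m \<rightharpoonup> 'q) \<Rightarrow> ('m \<rightharpoonup> 'q)" where
  "translate G M \<phi> g p = (\<lambda>m. if m \<in> M then p (\<phi> (inv\<^bsub>G\<^esub> g) m) else None)"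

lemma (in left_homogeneous_space) dom_translate:
  assumes "g \<in> carrier G" and "dom p \<subseteq> M"
  shows "dom (translate G M \<phi> g p) = \<phi> g ` dom p"
proof -
  interpret group G using group_hom group_hom.axioms(1) by blast
  have inv_act: "\<phi> (inv g) (\<phi> g m) = m" "\<phi> g (\<phi> (inv g) m) = m" "\<phi> g m \<in> M" if "m \<in> M" for m
  proof -
    show "\<phi> g m \<in> M"
      using element_image[OF assms(1) that] by simp
    show "\<phi> (inv g) (\<phi> g m) = m"
      using composition_rule[OF that, of "inv g" g] assms(1) id_eq_one that by (metis inv_closed l_inv restrict_apply')
    show "\<phi> g (\<phi> (inv g) m) = m"
      using composition_rule[OF that, of g "inv g"] assms(1) id_eq_one that by (metis inv_closed r_inv restrict_apply')
  qed
  show ?thesis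
  proof (intro equalityI subsetI)
    fix m assume "m \<in> dom (translate G M \<phi> g p)"
    then have "m \<in> M" "\<phi> (inv g) m \<in> dom p"
      by (auto simp: translate_def dom_def split: if_splits)
    then show "m \<in> \<phi> g ` dom p" using inv_act(2) by force
  next
    fix m assume "m \<in> \<phi> g ` dom p"
    then show "m \<in> dom (translate G M \<phi> g p)"
      using inv_act(1,3) assms(2) by (force simp: translate_def dom_def)
  qed
qed

definition semi_occurs ::
  "('g, 'z) monoid_scheme \<Rightarrow> 'm set \<Rightarrow> ('g \<Rightarrow> 'm \<Rightarrow> 'm) \<Rightarrow> 'g set \<Rightarrow>
   ('m \<rightharpoonup> 'q) \<Rightarrow> ('m \<rightharpoonup> 'q) \<Rightarrow> bool" where
  "semi_occurs G M \<phi> H p p' \<longleftrightarrow>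
     (\<exists>h\<in>H. \<phi> h ` dom p \<subseteq> dom p' \<and> translate G M \<phi> h p = p' |` (\<phi> h ` dom p))"

definition forbidding ::
  "('g, 'z) monoid_scheme \<Rightarrow> 'm set \<Rightarrow> ('g \<Rightarrow> 'm \<Rightarrow> 'm) \<Rightarrow> 'g set \<Rightarrow> 'q set \<Rightarrow>
   ('m \<rightharpoonup> 'q) set \<Rightarrow> ('m \<rightharpoonup> 'q) set" where
  "forbidding G M \<phi> H Q F = {c \<in> patterns Q M. \<forall>f\<in>F. \<not> semi_occurs G M \<phi> H f c}"

definition subshift ::
  "('g, 'z) monoid_scheme \<Rightarrow> 'm set \<Rightarrow> ('g \<Rightarrow> 'm \<Rightarrow> 'm) \<Rightarrow> 'g set \<Rightarrow> 'q set \<Rightarrow>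
   ('m \<rightharpoonup> 'q) set \<Rightarrow> bool" where
  "subshift G M \<phi> H Q \<X> \<longleftrightarrow>
     (\<exists>F. F \<subseteq> finite_patterns Q M \<and> \<X> = forbidding G M \<phi> H Q F)"

definition subshift_of_finite_type ::
  "('g, 'z) monoid_scheme \<Rightarrow> 'm set \<Rightarrow> ('g \<Rightarrow> 'm \<Rightarrow> 'm) \<Rightarrow> 'g set \<Rightarrow> 'q set \<Rightarrow>
   ('m \<rightharpoonup> 'q) set \<Rightarrow> bool" where
  "subshift_of_finite_type G M \<phi> H Q \<X> \<longleftrightarrow>
     (\<exists>F. finite F \<and> F \<subseteq> finite_patterns Q M \<and> \<X> = forbidding G M \<phi> H Q F)"

definition allowed ::
  "('g, 'z) monoid_scheme \<Rightarrow> 'm set \<Rightarrow> ('g \<Rightarrow> 'm \<Rightarrow> 'm) \<Rightarrow> 'g set \<Rightarrow>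
   ('m \<rightharpoonup> 'q) set \<Rightarrow> ('m \<rightharpoonup> 'q) \<Rightarrow> bool" where
  "allowed G M \<phi> H \<X> p \<longleftrightarrow> (\<exists>x\<in>\<X>. semi_occurs G M \<phi> H p x)"

definition strongly_irreducible ::
  "('g, 'z) monoid_scheme \<Rightarrow> 'm set \<Rightarrow> ('g \<Rightarrow> 'm \<Rightarrow> 'm) \<Rightarrow> ('g, 'm) coords \<Rightarrow> 'g set \<Rightarrow>
   'g set set \<Rightarrow> 'q set \<Rightarrow> ('m \<rightharpoonup> 'q) set \<Rightarrow> bool" where
  "strongly_irreducible G M \<phi> K H S Q \<X> \<longleftrightarrow> subshift G M \<phi> H Q \<X> \<and>
     (\<exists>\<kappa>::nat. \<forall>p \<in> finite_patterns Q M. \<forall>p' \<in> finite_patterns Q M.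
        allowed G M \<phi> H \<X> p \<longrightarrow> allowed G M \<phi> H \<X> p' \<longrightarrow>
        path_setdist G M \<phi> K S (dom p) (dom p') \<ge> enat (\<kappa> + 1) \<longrightarrow>
        (\<exists>x\<in>\<X>. x |` dom p = p \<and> x |` dom p' = p'))"


section \<open>Local maps and the Moore and Myhill properties\<close>

definition restrictions :: "('m \<rightharpoonup> 'q) set \<Rightarrow> 'm set \<Rightarrow> ('m \<rightharpoonup> 'q) set" where
  "restrictions \<X> A = (\<lambda>x. x |` A) ` \<X>"

definition local_map ::
  "('g, 'z) monoid_scheme \<Rightarrow> 'm set \<Rightarrow> ('g \<Rightarrow> 'm \<Rightarrow> 'm) \<Rightarrow> ('g, 'm) coords \<Rightarrow> 'g set \<Rightarrow>
   'g set set \<Rightarrow> 'q set \<Rightarrow> ('m \<rightharpoonup> 'q) set \<Rightarrow> ('m \<rightharpoonup> 'q) set \<Rightarrow>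
   (('m \<rightharpoonup> 'q) \<Rightarrow> ('m \<rightharpoonup> 'q)) \<Rightarrow> bool" where
  "local_map G M \<phi> K H S Q \<X> \<Y> \<Delta> \<longleftrightarrow> \<Delta> \<in> \<X> \<rightarrow> \<Y> \<and>
     (\<exists>(\<kappa>::nat) N \<delta>. N \<subseteq> path_ball G M \<phi> K S \<kappa> \<and>
        (\<forall>g \<in> origin_stabiliser G \<phi> K. \<phi> g ` N \<subseteq> N) \<and>
        \<delta> \<in> restrictions \<X> N \<rightarrow> Q \<and>
        (\<forall>h \<in> H \<inter> origin_stabiliser G \<phi> K. \<forall>l \<in> restrictions \<X> N.
           \<delta> (translate G M \<phi> h l) = \<delta> l) \<and>
        (\<forall>x\<in>\<X>. \<forall>m\<in>M. \<Delta> x m = Some (\<delta> ((\<lambda>n. x (semi_act_point G \<phi> K m n)) |` N))))"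

definition pre_injective ::
  "'m set \<Rightarrow> ('m \<rightharpoonup> 'q) set \<Rightarrow> (('m \<rightharpoonup> 'q) \<Rightarrow> ('m \<rightharpoonup> 'q)) \<Rightarrow> bool" where
  "pre_injective M \<X> \<Delta> \<longleftrightarrow>
     (\<forall>x\<in>\<X>. \<forall>x'\<in>\<X>. finite {m \<in> M. x m \<noteq> x' m} \<longrightarrow> \<Delta> x = \<Delta> x' \<longrightarrow> x = x')"

definition moore_property ::
  "('g, 'z) monoid_scheme \<Rightarrow> 'm set \<Rightarrow> ('g \<Rightarrow> 'm \<Rightarrow> 'm) \<Rightarrow> ('g, 'm) coords \<Rightarrow> 'g set \<Rightarrow>
   'g set set \<Rightarrow> 'q set \<Rightarrow> ('m \<rightharpoonup> 'q) set \<Rightarrow> bool" where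
  "moore_property G M \<phi> K H S Q \<X> \<longleftrightarrow>
     (\<forall>\<Delta>. local_map G M \<phi> K H S Q \<X> \<X> \<Delta> \<longrightarrow> \<Delta> ` \<X> = \<X> \<longrightarrow> pre_injective M \<X> \<Delta>)"

definition myhill_property ::
  "('g, 'z) monoid_scheme \<Rightarrow> 'm set \<Rightarrow> ('g \<Rightarrow> 'm \<Rightarrow> 'm) \<Rightarrow> ('g, 'm) coords \<Rightarrow> 'g set \<Rightarrow>
   'g set set \<Rightarrow> 'q set \<Rightarrow> ('m \<rightharpoonup> 'q) set \<Rightarrow> bool" where
  "myhill_property G M \<phi> K H S Q \<X> \<longleftrightarrow>
     (\<forall>\<Delta>. local_map G M \<phi> K H S Q \<X> \<X> \<Delta> \<longrightarrow> pre_injective M \<X> \<Delta> \<longrightarrow> \<Delta> ` \<X> = \<X>)"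

end

theory Submission
  imports Defs "HOL-Analysis.Function_Topology"
begin

text \<open>
  The Cayley graph is a connected, locally finite graph on which \<open>G\<close> acts by automorphisms. It has
  Folner sets: otherwise some \<open>R\<close>-neighbourhood of every finite set is at least twice as large
  as the set, and Hall's theorem gives an injection \<open>M \<times> bool \<rightarrow> M\<close> of displacement at most \<open>R\<close>, which
  contradicts the existence of the invariant mean.

  Let \<open>F\<close> be a Folner set and \<open>T \<subseteq> F\<close> a maximal separated subset. By strong irreducibility,
  configurations that avoid one given allowed pattern around each point of \<open>T\<close> have at most
  \<open>(1 - \<epsilon>)\<^sup>|\<^sup>T\<^sup>|\<close> times as many restrictions to a neighbourhood of \<open>F\<close> as all configurations, which is less
  than the number of patterns on \<open>F\<close>. If \<open>\<Delta>\<close> is not surjective, its image avoids a pattern around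
  each point, but a pre-injective \<open>\<Delta>\<close> has at least as many image patterns near \<open>F\<close> as there are
  patterns on \<open>F\<close>. If \<open>\<Delta>\<close> is not pre-injective, two configurations with the same image differ in a
  finite set, so replacing one by the other shows that the configurations avoiding it around the
  points of \<open>T\<close> already have all images, and \<open>\<Delta>\<close> is not surjective.
\<close>

section \<open>Compactness and Hall's theorem\<close>

text \<open>Tychonoff: \<open>g\<close> is a cluster point of the net \<open>f\<close> in the product of the discrete spaces \<open>A i\<close>.\<close>

lemma finite_choice_cluster_point:
  fixes f :: "'i set \<Rightarrow> 'i \<Rightarrow> 'b"
  assumes fin: "\<And>i. i \<in> I \<Longrightarrow> finite (A i)"
    and f: "\<And>W i. finite W \<Longrightarrow> W \<subseteq> I \<Longrightarrow> i \<in> I \<Longrightarrow> f W i \<in> A i"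
  shows "\<exists>g. (\<forall>i\<in>I. g i \<in> A i) \<and> (\<forall>V. finite V \<and> V \<subseteq> I \<longrightarrow>
    (\<exists>W. finite W \<and> V \<subseteq> W \<and> W \<subseteq> I \<and> (\<forall>i\<in>V. g i = f W i)))"
proof -
  define P where "P = product_topology (\<lambda>i. discrete_topology (A i)) I"
  define f' where "f' W = restrict (f W) I" for W
  define D where "D V = {f' W | W. finite W \<and> V \<subseteq> W \<and> W \<subseteq> I}" for V
  define \<V> where "\<V> = {V. finite V \<and> V \<subseteq> I}"
  have top: "topspace P = (\<Pi>\<^sub>E i\<in>I. A i)"
    by (simp add: P_def)
  have comp: "compact_space P"
    unfolding P_def compact_space_product_topology by (auto simp: compact_space_discrete_topology fin)
  have D: "D V \<subseteq> topspace P" for V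
    unfolding top D_def f'_def using f by auto
  \<comment> \<open>The closures of the tails \<open>D V\<close> have the finite intersection
    property, because \<open>f'\<close> at the union of finitely many index sets lies in all their
    tails. Compactness then supplies a common point.\<close>
  have "\<Inter> ((\<lambda>V. Abstract_Topology.closure_of P (D V)) ` \<V>) \<noteq> {}"
  proof (rule comp[unfolded compact_space_fip, rule_format], safe)
    fix V show "closedin P (Abstract_Topology.closure_of P (D V))" by simp
  next
    fix \<F> assume "finite \<F>" "\<F> \<subseteq> (\<lambda>V. Abstract_Topology.closure_of P (D V)) ` \<V>" and e: "\<Inter>\<F> = {}"
    then obtain \<W> where W: "finite \<W>" "\<W> \<subseteq> \<V>" "\<F> = (\<lambda>V. Abstract_Topology.closure_of P (D V)) ` \<W>"
      by (meson finite_subset_image)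
    have "f' (\<Union>\<W>) \<in> D V" if "V \<in> \<W>" for V
      using W that unfolding D_def \<V>_def by blast
    then have "f' (\<Union>\<W>) \<in> \<Inter>\<F>"
      using W(3) closure_of_subset[OF D] by blast
    with e show False by blast
  qed
  then obtain g where g: "\<And>V. V \<in> \<V> \<Longrightarrow> g \<in> Abstract_Topology.closure_of P (D V)"
    by blast
  have gA: "g \<in> (\<Pi>\<^sub>E i\<in>I. A i)"
    using g[of "{}"] closure_of_subset_topspace[of P] unfolding top \<V>_def by blast
  show ?thesis
  proof (intro exI[of _ g] conjI ballI allI impI)
    show "g i \<in> A i" if "i \<in> I" for i using gA that by auto
  next
    fix V assume "finite V \<and> V \<subseteq> I"
    then have V: "finite V" "V \<subseteq> I" by auto
    \<comment> \<open>Only the finitely many coordinates in \<open>V\<close> are constrained and the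
      factors are discrete, so \<open>U\<close> is an open neighbourhood of \<open>g\<close> and
      must meet the tail \<open>D V\<close>.\<close>
    define U where "U = (\<Pi>\<^sub>E i\<in>I. if i \<in> V then {g i} else A i)"
    have "openin P U"
      unfolding P_def U_def openin_PiE_gen
      using gA V by (auto intro: finite_subset[OF _ V(1)])
    moreover have "g \<in> U" using gA unfolding U_def by (auto simp: PiE_iff)
    moreover have "g \<in> Abstract_Topology.closure_of P (D V)" using V g by (auto simp: \<V>_def)
    ultimately obtain h where "h \<in> D V" "h \<in> U" by (auto simp: in_closure_of)
    then obtain W where W: "finite W" "V \<subseteq> W" "W \<subseteq> I" "f' W \<in> U" by (auto simp: D_def)
    have "g i = f W i" if "i \<in> V" for i
    proof -
      have "f' W i \<in> {g i}" using W(4) V that unfolding U_def by (auto simp: PiE_iff split: if_splits)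
      then show ?thesis using V that by (auto simp: f'_def)
    qed
    with W show "\<exists>W. finite W \<and> V \<subseteq> W \<and> W \<subseteq> I \<and> (\<forall>i\<in>V. g i = f W i)" by blast
  qed
qed

text \<open>Induction on the size of \<open>I\<close>. If some nonempty proper \<open>J\<close> has
  exactly \<open>card J\<close> neighbours, \<open>J\<close> and \<open>I - J\<close> are matched
  separately, the latter avoiding the neighbours of \<open>J\<close>. Otherwise every nonempty
  proper subset has a surplus, so one index can be matched arbitrarily.\<close>

lemma hall_finite:
  fixes A :: "'i \<Rightarrow> 'b set"
  assumes "finite I" and "\<And>i. i \<in> I \<Longrightarrow> finite (A i)"
    and "\<And>J. J \<subseteq> I \<Longrightarrow> card J \<le> card (\<Union> (A ` J))"
  shows "\<exists>f. inj_on f I \<and> (\<forall>i\<in>I. f i \<in> A i)"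
  using assms
proof (induction "card I" arbitrary: I A rule: less_induct)
  case less
  note finI = less.prems(1) and finA = less.prems(2) and hall = less.prems(3)
  show ?case
  proof (cases "\<exists>J. J \<subset> I \<and> J \<noteq> {} \<and> card (\<Union> (A ` J)) = card J")
    case True
    then obtain J where J: "J \<subset> I" "J \<noteq> {}" "card (\<Union> (A ` J)) = card J" by blast
    have finJ: "finite J" using J finI finite_subset by blast
    let ?U = "\<Union> (A ` J)"
    have finU: "finite ?U" using J finJ finA by blast
    obtain f where f: "inj_on f J" "\<forall>i\<in>J. f i \<in> A i"
      using less.hyps[of J A] J finJ finA hall psubset_card_mono[OF finI J(1)] by blast
    have "\<exists>g. inj_on g (I - J) \<and> (\<forall>i\<in>I - J. g i \<in> A i - ?U)"
    proof (rule less.hyps)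
      show "card (I - J) < card I"
        using J finI by (intro psubset_card_mono) auto
      fix L assume L: "L \<subseteq> I - J"
      have finL: "finite L" using L finI finite_subset by blast
      \<comment> \<open>Hall's condition for \<open>L\<close> after the removal of \<open>?U\<close>
        comes from the condition for \<open>L \<union> J\<close>: the tightness of \<open>J\<close>
        cancels \<open>card J\<close> against \<open>card ?U\<close>.\<close>
      have eq: "\<Union> (A ` (L \<union> J)) = (\<Union>i\<in>L. A i - ?U) \<union> ?U" by blast
      have "card L + card J = card (L \<union> J)"
        using L finL finJ by (subst card_Un_disjoint) auto
      also have "\<dots> \<le> card (\<Union> (A ` (L \<union> J)))"
        using L J by (intro hall) auto
      also have "\<dots> = card (\<Union>i\<in>L. A i - ?U) + card ?U"
        unfolding eq using finU finL finA L by (intro card_Un_disjoint) auto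
      finally show "card L \<le> card (\<Union>i\<in>L. A i - ?U)" using J(3) by linarith
    qed (use finI finA in auto)
    then obtain g where g: "inj_on g (I - J)" "\<forall>i\<in>I - J. g i \<in> A i - ?U" by blast
    let ?h = "\<lambda>i. if i \<in> J then f i else g i"
    have "inj_on ?h I"
    proof (rule inj_onI)
      fix x y assume xy: "x \<in> I" "y \<in> I" "?h x = ?h y"
      show "x = y"
      proof (cases "x \<in> J"; cases "y \<in> J")
        assume "x \<in> J" "y \<in> J" then show ?thesis using f xy by (auto dest: inj_onD)
      next
        assume "x \<in> J" "y \<notin> J"
        then have "f x \<in> ?U" "g y \<notin> ?U" using f g xy(1,2) by blast+
        then show ?thesis using xy \<open>x \<in> J\<close> \<open>y \<notin> J\<close> by auto
      next
        assume "x \<notin> J" "y \<in> J"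
        then have "f y \<in> ?U" "g x \<notin> ?U" using f g xy(1,2) by blast+
        then show ?thesis using xy \<open>x \<notin> J\<close> \<open>y \<in> J\<close> by auto
      next
        assume "x \<notin> J" "y \<notin> J" then show ?thesis using g xy by (auto dest: inj_onD)
      qed
    qed
    moreover have "\<forall>i\<in>I. ?h i \<in> A i" using f g by auto
    ultimately show ?thesis by blast
  next
    case False
    show ?thesis
    proof (cases "I = {}")
      case True then show ?thesis by simp
    next
      case False' : False
      then obtain a where a: "a \<in> I" by blast
      have "card {a} \<le> card (\<Union> (A ` {a}))" using a by (intro hall) auto
      then obtain b where b: "b \<in> A a" by fastforce
      have "\<exists>g. inj_on g (I - {a}) \<and> (\<forall>i\<in>I - {a}. g i \<in> A i - {b})"
      proof (rule less.hyps)
        show "card (I - {a}) < card I" using a finI by (intro psubset_card_mono) auto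
        fix L assume L: "L \<subseteq> I - {a}"
        have finU: "finite (\<Union> (A ` L))" using L finI finA finite_subset[of L I] by blast
        have eq: "(\<Union>i\<in>L. A i - {b}) = \<Union> (A ` L) - {b}" by blast
        show "card L \<le> card (\<Union>i\<in>L. A i - {b})"
        proof (cases "L = {}")
          case False'': False
          have "card L \<le> card (\<Union> (A ` L))" using L by (intro hall) auto
          \<comment> \<open>No proper nonempty subset is tight, so \<open>L\<close> has at least one
            spare neighbour, which pays for the removal of \<open>b\<close>.\<close>
          moreover have "card (\<Union> (A ` L)) \<noteq> card L" using L a False False'' by blast
          ultimately show ?thesis
            unfolding eq using card_Diff_singleton_if[of "\<Union> (A ` L)" b] finU by auto
        qed simp
      qed (use finI finA in auto)
      then obtain g where g: "inj_on g (I - {a})" "\<forall>i\<in>I - {a}. g i \<in> A i - {b}" by blast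
      let ?h = "g(a := b)"
      have "inj_on ?h I"
        using g a by (auto simp: inj_on_def)
      moreover have "\<forall>i\<in>I. ?h i \<in> A i" using g b by auto
      ultimately show ?thesis by blast
    qed
  qed
qed

text \<open>Each finite \<open>W\<close> has a matching by \<open>hall_finite\<close>, and a cluster
  point of these matchings is again injective, as injectivity involves only two indices at a
  time.\<close>

lemma hall_locally_finite:
  fixes A :: "'i \<Rightarrow> 'b set"
  assumes fin: "\<And>i. i \<in> I \<Longrightarrow> finite (A i)"
    and hall: "\<And>J. finite J \<Longrightarrow> J \<subseteq> I \<Longrightarrow> card J \<le> card (\<Union> (A ` J))"
  obtains f where "inj_on f I" and "\<And>i. i \<in> I \<Longrightarrow> f i \<in> A i"
proof -
  have ne: "A i \<noteq> {}" if "i \<in> I" for i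
    using hall[of "{i}"] that by auto
  have "\<exists>f. inj_on f W \<and> (\<forall>i\<in>I. f i \<in> A i)" if W: "finite W" "W \<subseteq> I" for W
  proof -
    have "card J \<le> card (\<Union> (A ` J))" if "J \<subseteq> W" for J
      using hall[of J] that W finite_subset by blast
    then obtain f where f: "inj_on f W" "\<forall>i\<in>W. f i \<in> A i"
      using hall_finite[of W A] W fin by blast
    \<comment> \<open>The values off \<open>W\<close> are arbitrary members of \<open>A i\<close>;
      they are there because the compactness argument needs functions on all of
      \<open>I\<close>.\<close>
    let ?g = "\<lambda>i. if i \<in> W then f i else SOME b. b \<in> A i"
    have "inj_on ?g W" using f by (auto simp: inj_on_def)
    moreover have "\<forall>i\<in>I. ?g i \<in> A i" using f ne by (auto simp: some_in_eq)
    ultimately show ?thesis by blast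
  qed
  then have "\<forall>W\<in>{W. finite W \<and> W \<subseteq> I}. \<exists>f. inj_on f W \<and> (\<forall>i\<in>I. f i \<in> A i)"
    by blast
  then obtain F where "\<forall>W\<in>{W. finite W \<and> W \<subseteq> I}. inj_on (F W) W \<and> (\<forall>i\<in>I. F W i \<in> A i)"
    by (rule bchoice[THEN exE])
  then have F: "\<And>W. finite W \<Longrightarrow> W \<subseteq> I \<Longrightarrow> inj_on (F W) W"
    "\<And>W i. finite W \<Longrightarrow> W \<subseteq> I \<Longrightarrow> i \<in> I \<Longrightarrow> F W i \<in> A i"
    by blast+
  have "\<exists>g. (\<forall>i\<in>I. g i \<in> A i) \<and> (\<forall>V. finite V \<and> V \<subseteq> I \<longrightarrow>
      (\<exists>W. finite W \<and> V \<subseteq> W \<and> W \<subseteq> I \<and> (\<forall>i\<in>V. g i = F W i)))"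
    by (rule finite_choice_cluster_point[of I A F, OF fin F(2)])
  then obtain g where gA: "\<forall>i\<in>I. g i \<in> A i"
    and g: "\<forall>V. finite V \<and> V \<subseteq> I \<longrightarrow> (\<exists>W. finite W \<and> V \<subseteq> W \<and> W \<subseteq> I \<and> (\<forall>i\<in>V. g i = F W i))"
    by (elim exE conjE) (rule that)
  have "inj_on g I"
  proof (rule inj_onI)
    fix i j assume ij: "i \<in> I" "j \<in> I" "g i = g j"
    obtain W where W: "finite W" "{i, j} \<subseteq> W" "W \<subseteq> I" "\<forall>k\<in>{i, j}. g k = F W k"
      using g[rule_format, of "{i, j}"] ij by auto
    then show "i = j" using F(1)[of W] ij by (auto dest: inj_onD)
  qed
  with gA show ?thesis using that by blast
qed

section \<open>Counting patterns\<close>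

lemma restrict_map_eq_iff: "x |` A = y |` A \<longleftrightarrow> (\<forall>a\<in>A. x a = y a)"
  by (auto simp: restrict_map_def fun_eq_iff)

lemma patterns_None: "x \<in> patterns Q A \<Longrightarrow> a \<notin> A \<Longrightarrow> x a = None"
  by (auto simp: patterns_def)

lemma restrict_in_patterns:
  assumes "x \<in> patterns Q M" "F \<subseteq> M"
  shows "x |` F \<in> patterns Q F"
proof -
  have "ran (x |` F) \<subseteq> ran x" by (auto simp: ran_def restrict_map_def split: if_splits)
  then show ?thesis using assms by (auto simp: patterns_def dom_restrict)
qed

lemma finite_card_patterns:
  assumes "finite Q" "finite A"
  shows "finite (patterns Q A)" "card (patterns Q A) \<le> card Q ^ card A"
proof -
  let ?e = "\<lambda>f a. if a \<in> A then Some (f a) else None"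
  have sub: "patterns Q A \<subseteq> ?e ` (A \<rightarrow>\<^sub>E Q)"
  proof
    fix p assume p: "p \<in> patterns Q A"
    have "p = ?e (restrict (the \<circ> p) A)"
      using p by (auto simp: patterns_def fun_eq_iff dom_def)
    moreover have "restrict (the \<circ> p) A \<in> A \<rightarrow>\<^sub>E Q"
      using p by (force simp: patterns_def dom_def ran_def)
    ultimately show "p \<in> ?e ` (A \<rightarrow>\<^sub>E Q)" by blast
  qed
  have fin: "finite (A \<rightarrow>\<^sub>E Q)" using assms by (intro finite_PiE) auto
  show "finite (patterns Q A)" using sub fin finite_subset by blast
  have "card (patterns Q A) \<le> card (A \<rightarrow>\<^sub>E Q)"
    by (rule surj_card_le[OF fin sub])
  then show "card (patterns Q A) \<le> card Q ^ card A"
    using assms by (simp add: card_PiE)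
qed

lemma finite_restrictions:
  assumes "finite Q" "finite F" "F \<subseteq> M" "Z \<subseteq> patterns Q M"
  shows "finite (restrictions Z F)"
proof -
  have "restrictions Z F \<subseteq> patterns Q F"
    unfolding restrictions_def using assms(4) restrict_in_patterns[OF _ assms(3), of _ Q] by blast
  then show ?thesis using finite_card_patterns(1)[OF assms(1,2)] finite_subset by blast
qed

text \<open>A pattern on \<open>F\<close> is determined by its parts on \<open>V\<close> and on
  \<open>F - V\<close>. This is used with \<open>F - V\<close> a single ball, to bound the number of
  extensions, and with \<open>F - V\<close> the boundary of a Folner set.\<close>

lemma card_restrictions_le:
  assumes "finite Q" "finite F" "F \<subseteq> M" "Z \<subseteq> patterns Q M" "V \<subseteq> F"
  shows "card (restrictions Z F) \<le> card Q ^ card (F - V) * card (restrictions Z V)"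
proof -
  have V: "finite V" "V \<subseteq> M" using assms finite_subset by blast+
  have sub: "restrictions Z F \<subseteq> (\<lambda>(u, w). u ++ w) ` (restrictions Z V \<times> patterns Q (F - V))"
  proof
    fix u assume "u \<in> restrictions Z F"
    then obtain x where x: "x \<in> Z" "u = x |` F" by (auto simp: restrictions_def)
    have "u = x |` V ++ x |` (F - V)"
      using x assms(5) by (auto simp: fun_eq_iff map_add_def restrict_map_def split: option.splits)
    moreover have "x |` (F - V) \<in> patterns Q (F - V)"
      using x assms(3,4) by (intro restrict_in_patterns[of x Q M]) auto
    ultimately show "u \<in> (\<lambda>(u, w). u ++ w) ` (restrictions Z V \<times> patterns Q (F - V))"
      using x(1) by (auto simp: restrictions_def)
  qed
  have fin: "finite (restrictions Z V)" "finite (patterns Q (F - V))"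
    using finite_restrictions[OF assms(1) V assms(4)] finite_card_patterns(1)[of Q "F - V"] assms(1,2) by auto
  have "card (restrictions Z F) \<le> card (restrictions Z V \<times> patterns Q (F - V))"
    by (rule surj_card_le[OF finite_cartesian_product[OF fin] sub])
  also have "\<dots> \<le> card (restrictions Z V) * card Q ^ card (F - V)"
    unfolding card_cartesian_product
    using finite_card_patterns(2)[of Q "F - V"] assms(1,2) by (intro mult_le_mono) auto
  finally show ?thesis by (simp add: mult.commute)
qed

section \<open>Uniformly locally finite spaces and Folner sets\<close>

text \<open>All counting takes place in terms of balls with these properties. The group enters only
  later, through the balls \<open>cball\<close> of the Cayley graph.\<close>

locale coarse_space =
  fixes M :: "'m set" and B :: "nat \<Rightarrow> 'm \<Rightarrow> 'm set"
  assumes ball_self: "m \<in> M \<Longrightarrow> m \<in> B r m"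
    and ball_subset: "m \<in> M \<Longrightarrow> B r m \<subseteq> M"
    and ball_sym: "m \<in> M \<Longrightarrow> n \<in> B r m \<Longrightarrow> m \<in> B r n"
    and ball_triangle: "m \<in> M \<Longrightarrow> n \<in> B r m \<Longrightarrow> l \<in> B s n \<Longrightarrow> l \<in> B (r + s) m"
    and bounded_geometry: "\<exists>b. \<forall>m\<in>M. finite (B r m) \<and> card (B r m) \<le> b"
begin

definition nbhd :: "nat \<Rightarrow> 'm set \<Rightarrow> 'm set" where
  "nbhd r F = (\<Union>m\<in>F. B r m)"

lemma ball_mono:
  assumes "m \<in> M" "r \<le> s"
  shows "B r m \<subseteq> B s m"
proof
  fix n assume n: "n \<in> B r m"
  then have "n \<in> M" using assms ball_subset by blast
  then show "n \<in> B s m"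
    using ball_triangle[OF assms(1) n ball_self, of "s - r"] assms(2) by simp
qed

lemma finite_ball: "m \<in> M \<Longrightarrow> finite (B r m)"
  using bounded_geometry by blast

lemma nbhd_subset: "F \<subseteq> M \<Longrightarrow> nbhd r F \<subseteq> M"
  using ball_subset by (auto simp: nbhd_def)

lemma finite_nbhd: "F \<subseteq> M \<Longrightarrow> finite F \<Longrightarrow> finite (nbhd r F)"
  using finite_ball by (auto simp: nbhd_def)

lemma subset_nbhd: "F \<subseteq> M \<Longrightarrow> F \<subseteq> nbhd r F"
  using ball_self by (auto simp: nbhd_def)

lemma nbhd_mono: "F \<subseteq> M \<Longrightarrow> r \<le> s \<Longrightarrow> nbhd r F \<subseteq> nbhd s F"
  unfolding nbhd_def using ball_mono by blast

lemma nbhd_nbhd: "F \<subseteq> M \<Longrightarrow> nbhd s (nbhd r F) \<subseteq> nbhd (r + s) F"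
  unfolding nbhd_def using ball_triangle by blast

lemma ball_nbhd_disjoint:
  assumes "A \<subseteq> M" "m \<in> M" "m \<notin> nbhd r A"
  shows "B r m \<inter> A = {}"
  using assms ball_sym unfolding nbhd_def by blast

lemma ball_meets_nbhd:
  assumes "A \<subseteq> M" "m \<in> M" "B r m \<inter> A \<noteq> {}"
  shows "B r m \<subseteq> nbhd (2 * r) A"
proof
  fix n assume n: "n \<in> B r m"
  obtain a where a: "a \<in> B r m" "a \<in> A" using assms by blast
  have "m \<in> B r a" using ball_sym assms a by blast
  then have "n \<in> B (r + r) a" using ball_triangle n a assms by blast
  then show "n \<in> nbhd (2 * r) A" using a by (auto simp: nbhd_def mult_2)
qed

text \<open>Greedy choice: a point of \<open>F\<close> is added only if no ball around an earlier
  choice covers it. The resulting \<open>r\<close>-balls cover \<open>F\<close>, which bounds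
  \<open>card F\<close> by \<open>b\<close> times their number.\<close>

lemma separated_net:
  assumes "finite F" "F \<subseteq> M" and b: "\<forall>m\<in>M. card (B r m) \<le> b"
  obtains T where "T \<subseteq> F" "\<And>t u. t \<in> T \<Longrightarrow> u \<in> T \<Longrightarrow> t \<noteq> u \<Longrightarrow> u \<notin> B r t"
    "card F \<le> b * card T"
proof -
  have "\<exists>T\<subseteq>F. (\<forall>t\<in>T. \<forall>u\<in>T. t \<noteq> u \<longrightarrow> u \<notin> B r t) \<and> F \<subseteq> nbhd r T"
    using assms(1,2)
  proof induction
    case empty then show ?case by (auto simp: nbhd_def)
  next
    case (insert a F)
    then obtain T where T: "T \<subseteq> F" "\<forall>t\<in>T. \<forall>u\<in>T. t \<noteq> u \<longrightarrow> u \<notin> B r t" "F \<subseteq> nbhd r T"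
      by auto
    show ?case
    proof (cases "a \<in> nbhd r T")
      case True
      with T show ?thesis by (intro exI[of _ T]) auto
    next
      case False
      have "t \<notin> B r a" if "t \<in> T" for t
        using False that ball_sym insert.prems unfolding nbhd_def by blast
      moreover have "insert a F \<subseteq> nbhd r (insert a T)"
        using T(3) ball_self insert.prems by (auto simp: nbhd_def)
      ultimately show ?thesis
        using T False by (intro exI[of _ "insert a T"]) (auto simp: nbhd_def)
    qed
  qed
  then obtain T where T: "T \<subseteq> F" "\<forall>t\<in>T. \<forall>u\<in>T. t \<noteq> u \<longrightarrow> u \<notin> B r t" "F \<subseteq> nbhd r T"
    by blast
  have TM: "finite T" "T \<subseteq> M" using T(1) assms finite_subset by blast+
  have "card F \<le> card (nbhd r T)"
    using T(3) TM finite_nbhd by (intro card_mono) auto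
  also have "\<dots> \<le> (\<Sum>t\<in>T. card (B r t))"
    unfolding nbhd_def using TM by (intro card_UN_le) auto
  also have "\<dots> \<le> (\<Sum>t\<in>T. b)"
    using b TM by (intro sum_mono) auto
  finally have "card F \<le> b * card T" by (simp add: mult.commute)
  with T show ?thesis using that[of T] by blast
qed

text \<open>
  Iterating an isoperimetric inequality makes neighbourhoods of a fixed radius twice as large as
  the set, and then Hall's theorem doubles \<open>M\<close>.
\<close>

lemma folner_if_not_paradoxical:
  assumes no_doubling:
    "\<And>f R. inj_on f (M \<times> (UNIV :: bool set)) \<Longrightarrow> (\<And>m i. m \<in> M \<Longrightarrow> f (m, i) \<in> B R m) \<Longrightarrow> False"
  shows "\<exists>F. finite F \<and> F \<subseteq> M \<and> F \<noteq> {} \<and> n * card (nbhd r F - F) \<le> card F"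
proof (rule ccontr)
  assume "\<not> ?thesis"
  then have exp: "card F < n * card (nbhd r F - F)" if "finite F" "F \<subseteq> M" "F \<noteq> {}" for F
    using that not_le by blast
  have "M \<noteq> {}" using no_doubling by auto
  then obtain m where "m \<in> M" by blast
  \<comment> \<open>For \<open>n = 0\<close> the Folner inequality would hold trivially for a
    singleton.\<close>
  then have n: "n > 0" using exp[of "{m}"] by (cases n) auto
  have grow: "(n + 1) * card F \<le> n * card (nbhd r F)" if F: "finite F" "F \<subseteq> M" for F
  proof (cases "F = {}")
    case False
    have "card (nbhd r F) = card F + card (nbhd r F - F)"
      using F subset_nbhd finite_nbhd
      by (metis Diff_disjoint Diff_partition card_Un_disjoint finite_Diff)
    then show ?thesis using exp[OF F False] by (simp add: algebra_simps)
  qed simp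
  have iter: "(n + 1) ^ j * card F \<le> n ^ j * card (nbhd (j * r) F)"
    if F: "finite F" "F \<subseteq> M" for F j
  proof (induction j)
    case 0
    then show ?case using F subset_nbhd[of F 0] finite_nbhd[of F 0] by (simp add: card_mono)
  next
    case (Suc j)
    let ?N = "nbhd (j * r) F"
    have N: "finite ?N" "?N \<subseteq> M" using F finite_nbhd nbhd_subset by auto
    have "(n + 1) ^ Suc j * card F = (n + 1) * ((n + 1) ^ j * card F)" by (simp only: power_Suc mult.assoc)
    also have "\<dots> \<le> (n + 1) * (n ^ j * card ?N)" using Suc by (rule mult_le_mono2)
    also have "\<dots> = n ^ j * ((n + 1) * card ?N)" by (simp only: mult_ac)
    also have "\<dots> \<le> n ^ j * (n * card (nbhd r ?N))" using grow[OF N] by (rule mult_le_mono2)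
    also have "card (nbhd r ?N) \<le> card (nbhd (Suc j * r) F)"
      using nbhd_nbhd[OF F(2), of r "j * r"] finite_nbhd[OF F(2,1), of "Suc j * r"]
      by (intro card_mono) (simp_all add: add.commute)
    finally show ?case by (simp add: mult_ac)
  qed
  \<comment> \<open>Each step of radius \<open>r\<close> enlarges a set by the factor
    \<open>1 + 1/n\<close>. By Bernoulli's inequality \<open>n\<close> steps at least double it,
    whence the choice \<open>R = n * r\<close>.\<close>
  have bern: "2 * n ^ n \<le> (n + 1) ^ n"
  proof -
    have "1 + real n * (1 / real n) \<le> (1 + 1 / real n) ^ n"
      by (rule Bernoulli_inequality) (use n in \<open>simp add: order_trans[of _ 0]\<close>)
    also have "\<dots> = ((real n + 1) / real n) ^ n" using n by (simp add: field_simps)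
    also have "\<dots> = (real n + 1) ^ n / real n ^ n" by (simp add: power_divide)
    finally have "2 * real n ^ n \<le> (real n + 1) ^ n" using n by (simp add: field_simps)
    then have "real (2 * n ^ n) \<le> real ((n + 1) ^ n)" by (simp add: add.commute)
    then show ?thesis by (rule of_nat_le_iff[THEN iffD1])
  qed
  define R where "R = n * r"
  have double: "2 * card F \<le> card (nbhd R F)" if F: "finite F" "F \<subseteq> M" for F
  proof -
    have "n ^ n * (2 * card F) \<le> (n + 1) ^ n * card F"
      using mult_le_mono1[OF bern, of "card F"] by (simp only: mult_ac)
    also have "\<dots> \<le> n ^ n * card (nbhd R F)" using iter[OF F] by (simp add: R_def)
    finally show ?thesis using n by simp
  qed
  \<comment> \<open>A set of pairs has at most twice as many elements as its projection to
    \<open>M\<close>, so doubling of neighbourhoods is exactly what Hall's condition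
    requires.\<close>
  have "\<exists>f. inj_on f (M \<times> (UNIV :: bool set)) \<and> (\<forall>p\<in>M \<times> (UNIV :: bool set). f p \<in> B R (fst p))"
  proof (rule hall_locally_finite[of "M \<times> (UNIV :: bool set)" "\<lambda>p. B R (fst p)"])
    fix J assume J: "finite J" "J \<subseteq> M \<times> (UNIV :: bool set)"
    have F: "finite (fst ` J)" "fst ` J \<subseteq> M" using J by auto
    have "J \<subseteq> fst ` J \<times> (UNIV :: bool set)" by force
    then have "card J \<le> card (fst ` J \<times> (UNIV :: bool set))"
      using F by (intro card_mono) auto
    also have "\<dots> \<le> card (nbhd R (fst ` J))"
      using double[OF F] by (simp add: card_cartesian_product mult.commute)
    finally show "card J \<le> card (\<Union> ((\<lambda>p. B R (fst p)) ` J))"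
      by (simp add: nbhd_def image_image)
  next
    fix p assume "p \<in> M \<times> (UNIV :: bool set)"
    then show "finite (B R (fst p))" using finite_ball by auto
  next
    fix f assume "inj_on f (M \<times> (UNIV :: bool set))"
      "\<And>p. p \<in> M \<times> (UNIV :: bool set) \<Longrightarrow> f p \<in> B R (fst p)"
    then show "\<exists>f. inj_on f (M \<times> (UNIV :: bool set)) \<and> (\<forall>p\<in>M \<times> (UNIV :: bool set). f p \<in> B R (fst p))"
      by blast
  qed
  then obtain f where f: "inj_on f (M \<times> (UNIV :: bool set))"
    and fB: "\<forall>p\<in>M \<times> (UNIV :: bool set). f p \<in> B R (fst p)"
    by blast
  show False
  proof (rule no_doubling[OF f])
    show "f (m, i) \<in> B R m" if "m \<in> M" for m i using bspec[OF fB, of "(m, i)"] that by simp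
  qed
qed

end

section \<open>Entropy drop\<close>

text \<open>Strong irreducibility is stated for restrictions of configurations, with the gap
  expressed by \<open>nbhd\<close>. In \<open>folner\<close> the factor \<open>n\<close> says that
  the boundary is at most the fraction \<open>1/n\<close> of the set.\<close>

locale irreducible_shift = coarse_space M B for M :: "'m set" and B +
  fixes Q :: "'q set" and X :: "('m \<rightharpoonup> 'q) set" and \<kappa> :: nat
  assumes finite_alphabet: "finite Q"
    and shift_patterns: "X \<subseteq> patterns Q M"
    and irreducible: "finite A \<Longrightarrow> A \<subseteq> M \<Longrightarrow> finite A' \<Longrightarrow> A' \<subseteq> M \<Longrightarrow> nbhd \<kappa> A \<inter> A' = {} \<Longrightarrow>
      x \<in> X \<Longrightarrow> y \<in> X \<Longrightarrow> \<exists>z\<in>X. z |` A = x |` A \<and> z |` A' = y |` A'"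
    and folner: "\<exists>F. finite F \<and> F \<subseteq> M \<and> F \<noteq> {} \<and> n * card (nbhd r F - F) \<le> card F"
begin

text \<open>The configuration \<open>w t\<close> stands for its restriction to the ball around
  \<open>t\<close>. It may depend on \<open>t\<close> because no group is available here to
  translate one pattern to all points.\<close>

definition avoiding :: "nat \<Rightarrow> ('m \<Rightarrow> 'm \<rightharpoonup> 'q) \<Rightarrow> 'm set \<Rightarrow> ('m \<rightharpoonup> 'q) set" where
  "avoiding \<rho> w T = {x \<in> X. \<forall>t\<in>T. x |` B \<rho> t \<noteq> w t |` B \<rho> t}"

lemma avoiding_patterns: "avoiding \<rho> w T \<subseteq> patterns Q M"
  using shift_patterns by (auto simp: avoiding_def)

text \<open>
  By irreducibility every configuration can be changed near \<open>t\<close> so that \<open>w t\<close> occurs there,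
  hence each pattern away from \<open>t\<close> loses at least one of its at most \<open>card Q ^ b\<close> extensions.
\<close>

lemma card_avoiding_insert:
  assumes F: "finite F" "F \<subseteq> M" and t: "t \<in> M" "B (\<rho> + \<kappa>) t \<subseteq> F"
    and T: "T \<subseteq> M" "\<And>u. u \<in> T \<Longrightarrow> B \<rho> u \<subseteq> F" "\<And>u. u \<in> T \<Longrightarrow> B (\<rho> + \<kappa>) t \<inter> B \<rho> u = {}"
    and w: "w t \<in> X" and b: "card (B (\<rho> + \<kappa>) t) \<le> b" and q: "Q \<noteq> {}"
  shows "real (card (restrictions (avoiding \<rho> w (insert t T)) F))
    \<le> (1 - 1 / real (card Q ^ b)) * real (card (restrictions (avoiding \<rho> w T) F))"
proof -
  let ?Z = "avoiding \<rho> w T" and ?Z' = "avoiding \<rho> w (insert t T)"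
  let ?U = "B (\<rho> + \<kappa>) t"
  let ?D = "restrictions ?Z F - restrictions ?Z' F"
  have q1: "card Q \<ge> 1" using q finite_alphabet by (simp add: Suc_leI card_gt_0_iff)
  have fin: "finite (restrictions ?Z F)"
    using finite_restrictions[OF finite_alphabet F avoiding_patterns] .
  have sub: "restrictions ?Z' F \<subseteq> restrictions ?Z F"
    by (auto simp: restrictions_def avoiding_def)
  have tF: "B \<rho> t \<subseteq> F" using ball_mono[OF t(1), of \<rho> "\<rho> + \<kappa>"] t by auto
  \<comment> \<open>Gluing \<open>w t\<close> on the inner ball to \<open>y\<close> outside the
    larger ball \<open>?U\<close> gives a pattern that is lost, so the lost patterns
    \<open>?D\<close> map onto all patterns away from \<open>?U\<close>.\<close>
  have "restrictions ?Z (F - ?U) \<subseteq> (\<lambda>u. u |` (F - ?U)) ` ?D"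
  proof
    fix u assume "u \<in> restrictions ?Z (F - ?U)"
    then obtain y where y: "y \<in> ?Z" "u = y |` (F - ?U)" by (auto simp: restrictions_def)
    have "nbhd \<kappa> (B \<rho> t) \<subseteq> ?U"
      using ball_triangle t(1) by (auto simp: nbhd_def)
    then obtain z where z: "z \<in> X" "z |` B \<rho> t = w t |` B \<rho> t" "z |` (F - ?U) = y |` (F - ?U)"
      using irreducible[of "B \<rho> t" "F - ?U" "w t" y] F t finite_ball ball_subset w y
      by (auto simp: avoiding_def)
    have "z |` B \<rho> u = y |` B \<rho> u" if "u \<in> T" for u
    proof -
      have "B \<rho> u \<subseteq> F - ?U" using T(2,3)[OF that] by blast
      then show ?thesis using z(3) unfolding restrict_map_eq_iff by blast
    qed
    then have "z \<in> ?Z" using y z by (auto simp: avoiding_def)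
    \<comment> \<open>The ball around \<open>t\<close> lies inside \<open>F\<close>, so every
      configuration with this restriction to \<open>F\<close> shows \<open>w t\<close> at
      \<open>t\<close>.\<close>
    moreover have "z |` F \<notin> restrictions ?Z' F"
    proof
      assume "z |` F \<in> restrictions ?Z' F"
      then obtain z' where z': "z' \<in> ?Z'" "z |` F = z' |` F" by (auto simp: restrictions_def)
      then have "z' |` B \<rho> t = w t |` B \<rho> t" using z(2) tF unfolding restrict_map_eq_iff by (metis subsetD)
      with z' show False by (auto simp: avoiding_def)
    qed
    ultimately have "z |` F \<in> ?D" by (auto simp: restrictions_def)
    moreover have "u = (z |` F) |` (F - ?U)" using y z by (simp add: Int_absorb1)
    ultimately show "u \<in> (\<lambda>u. u |` (F - ?U)) ` ?D" by blast
  qed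
  then have "card (restrictions ?Z (F - ?U)) \<le> card ?D"
    using fin by (intro surj_card_le) auto
  moreover have "F - (F - ?U) = ?U" using t by auto
  then have "card (restrictions ?Z F) \<le> card Q ^ card ?U * card (restrictions ?Z (F - ?U))"
    using card_restrictions_le[OF finite_alphabet F avoiding_patterns, of "F - ?U"] by auto
  moreover have "card Q ^ card ?U \<le> card Q ^ b"
    using q1 b by (intro power_increasing) auto
  ultimately have "card (restrictions ?Z F) \<le> card Q ^ b * card ?D"
    by (meson le_trans mult_le_mono)
  moreover have "card ?D = card (restrictions ?Z F) - card (restrictions ?Z' F)"
    using sub fin finite_subset by (intro card_Diff_subset) blast+
  moreover have "card (restrictions ?Z' F) \<le> card (restrictions ?Z F)"
    using sub fin by (rule card_mono[rotated])
  ultimately have "real (card (restrictions ?Z F))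
      \<le> real (card Q ^ b) * (real (card (restrictions ?Z F)) - real (card (restrictions ?Z' F)))"
    by (metis of_nat_diff of_nat_le_iff of_nat_mult)
  moreover have "real (card Q ^ b) > 0" using q1 by simp
  ultimately show ?thesis by (simp add: field_simps)
qed

lemma card_avoiding:
  assumes F: "finite F" "F \<subseteq> M" and T: "finite T" "T \<subseteq> M" "\<And>t. t \<in> T \<Longrightarrow> B (\<rho> + \<kappa>) t \<subseteq> F"
    and sep: "\<And>t u. t \<in> T \<Longrightarrow> u \<in> T \<Longrightarrow> t \<noteq> u \<Longrightarrow> B (\<rho> + \<kappa>) t \<inter> B \<rho> u = {}"
    and w: "\<And>t. t \<in> T \<Longrightarrow> w t \<in> X" and b: "\<And>t. t \<in> T \<Longrightarrow> card (B (\<rho> + \<kappa>) t) \<le> b"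
    and q: "Q \<noteq> {}"
  shows "real (card (restrictions (avoiding \<rho> w T) F))
    \<le> (1 - 1 / real (card Q ^ b)) ^ card T * real (card (restrictions X F))"
  using T sep w b
proof (induction rule: finite_induct)
  case empty
  then show ?case by (simp add: avoiding_def)
next
  case (insert t T)
  let ?c = "1 - 1 / real (card Q ^ b)"
  have q1: "card Q \<ge> 1" using q finite_alphabet by (simp add: Suc_leI card_gt_0_iff)
  then have c: "?c \<ge> 0" by (simp add: field_simps)
  have IH: "real (card (restrictions (avoiding \<rho> w T) F)) \<le> ?c ^ card T * real (card (restrictions X F))"
    by (rule insert.IH) (simp_all add: insert.prems[simplified])
  have "real (card (restrictions (avoiding \<rho> w (insert t T)) F))
      \<le> ?c * real (card (restrictions (avoiding \<rho> w T) F))"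
  proof (rule card_avoiding_insert[OF F _ _ _ _ _ _ _ q])
    fix u assume u: "u \<in> T"
    then have "u \<in> M" "B (\<rho> + \<kappa>) u \<subseteq> F" using insert.prems by auto
    then show "B \<rho> u \<subseteq> F" using ball_mono[of u \<rho> "\<rho> + \<kappa>"] by auto
    show "B (\<rho> + \<kappa>) t \<inter> B \<rho> u = {}" using insert.prems insert.hyps u by blast
  qed (use insert.prems in simp_all)
  also have "\<dots> \<le> ?c * (?c ^ card T * real (card (restrictions X F)))"
    using IH c by (rule mult_left_mono)
  also have "\<dots> = ?c ^ card (insert t T) * real (card (restrictions X F))"
    using insert.hyps by simp
  finally show ?case .
qed

text \<open>Passing from \<open>F\<close> to its \<open>R\<close>-neighbourhood multiplies the
  number of patterns by at most \<open>card Q\<close> per boundary point, while avoidance costs a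
  fixed factor below 1 per point of \<open>T\<close>. The number of points of \<open>T\<close> is
  proportional to \<open>card F\<close>, so a good enough Folner set makes the loss win. The sets
  are chosen before \<open>w\<close>.\<close>

lemma entropy_drop:
  assumes X: "X \<noteq> {}" and R: "\<rho> + \<kappa> \<le> R"
  obtains F T where "finite F" "F \<subseteq> M" "finite T" "T \<subseteq> M"
    "\<And>t u. t \<in> T \<Longrightarrow> u \<in> T \<Longrightarrow> t \<noteq> u \<Longrightarrow> B \<rho> t \<inter> B \<rho> u = {}"
    "\<And>w. (\<And>t. t \<in> T \<Longrightarrow> w t \<in> X) \<Longrightarrow>
      card (restrictions (avoiding \<rho> w T) (nbhd R F)) < card (restrictions X F)"
proof -
  \<comment> \<open>The bound \<open>b\<close> on the larger gluing balls governs the loss per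
    point; the bound \<open>a\<close> below governs the density of the separated set.\<close>
  obtain b where b: "\<forall>m\<in>M. finite (B (\<rho> + \<kappa>) m) \<and> card (B (\<rho> + \<kappa>) m) \<le> b"
    using bounded_geometry by blast
  obtain a where a: "\<forall>m\<in>M. finite (B (2 * \<rho> + \<kappa>) m) \<and> card (B (2 * \<rho> + \<kappa>) m) \<le> a"
    using bounded_geometry by blast
  \<comment> \<open>Since \<open>M\<close> is nonempty, a configuration takes some value, so
    \<open>Q\<close> is nonempty as well.\<close>
  have Mne: "M \<noteq> {}" using folner[of 0 0] by auto
  obtain x0 where x0: "x0 \<in> X" using X by blast
  then have x0p: "dom x0 = M" "ran x0 \<subseteq> Q" using shift_patterns by (auto simp: patterns_def)
  then have "ran x0 \<noteq> {}" using Mne by (auto simp: ran_def dom_def)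
  then have q: "Q \<noteq> {}" using x0p by blast
  then have q1: "card Q \<ge> 1" using finite_alphabet by (simp add: Suc_leI card_gt_0_iff)
  define c where "c = 1 - 1 / real (card Q ^ b)"
  have c: "0 \<le> c" "c < 1" using q1 by (auto simp: c_def field_simps)
  \<comment> \<open>With this \<open>k\<close>, the loss at \<open>k\<close> points of
    \<open>T\<close> outweighs the gain at one boundary point. The Folner constant
    \<open>a * k\<close> then guarantees \<open>k\<close> points of \<open>T\<close> for each
    boundary point.\<close>
  obtain k where "c ^ k < 1 / real (card Q)"
    using real_arch_pow_inv[OF _ c(2), of "1 / real (card Q)"] q1 by auto
  then have k: "real (card Q) * c ^ k < 1" using q1 by (simp add: field_simps)
  obtain F where F: "finite F" "F \<subseteq> M" "F \<noteq> {}" "(a * k) * card (nbhd R F - F) \<le> card F"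
    using folner by blast
  obtain T where T: "T \<subseteq> F" "\<And>t u. t \<in> T \<Longrightarrow> u \<in> T \<Longrightarrow> t \<noteq> u \<Longrightarrow> u \<notin> B (2 * \<rho> + \<kappa>) t"
    "card F \<le> a * card T"
    using separated_net[OF F(1,2), of "2 * \<rho> + \<kappa>" a] a by auto
  have TM: "finite T" "T \<subseteq> M" using T F finite_subset by blast+
  let ?N = "nbhd R F"
  let ?j = "card (?N - F)"
  have N: "finite ?N" "?N \<subseteq> M" "F \<subseteq> ?N"
    using F finite_nbhd nbhd_subset subset_nbhd by auto
  have Tpos: "card T > 0" using T(3) F by (cases "card T = 0") auto
  have apos: "a > 0" using T(3) F by (cases "a = 0") auto
  have kj: "k * ?j \<le> card T"
  proof -
    have "a * (k * ?j) \<le> a * card T" using F(4) T(3) unfolding mult.assoc by (rule le_trans)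
    then show ?thesis using apos by simp
  qed
  have small: "c ^ card T * real (card Q) ^ ?j < 1"
  proof (cases "?j = 0")
    case True
    then show ?thesis using c Tpos by (simp add: power_less_one_iff)
  next
    case False
    have "c ^ card T * real (card Q) ^ ?j \<le> c ^ (k * ?j) * real (card Q) ^ ?j"
      using c kj by (intro mult_right_mono power_decreasing) auto
    also have "\<dots> = (real (card Q) * c ^ k) ^ ?j"
      by (simp add: power_mult power_mult_distrib mult.commute)
    also have "\<dots> < 1" using k False c q1 by (intro power_less_one_iff[THEN iffD2]) auto
    finally show ?thesis .
  qed
  \<comment> \<open>The separation radius \<open>2 * \<rho> + \<kappa>\<close> is the sum of the two
    radii of balls that must not meet.\<close>
  have sep: "B (\<rho> + \<kappa>) t \<inter> B \<rho> u = {}" if "t \<in> T" "u \<in> T" "t \<noteq> u" for t u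
  proof (rule ccontr)
    assume "B (\<rho> + \<kappa>) t \<inter> B \<rho> u \<noteq> {}"
    then obtain m where m: "m \<in> B (\<rho> + \<kappa>) t" "m \<in> B \<rho> u" by blast
    then have "u \<in> B \<rho> m" using ball_sym TM that by blast
    then have "u \<in> B (\<rho> + \<kappa> + \<rho>) t" using ball_triangle[OF _ m(1)] TM that by blast
    then show False using T(2)[OF that] by (simp add: mult_2 add_ac)
  qed
  show ?thesis
  proof (rule that[OF F(1,2) TM])
    show "B \<rho> t \<inter> B \<rho> u = {}" if "t \<in> T" "u \<in> T" "t \<noteq> u" for t u
      using sep[OF that] ball_mono[of t \<rho> "\<rho> + \<kappa>"] TM that by auto
  next
    fix w assume w: "\<And>t. t \<in> T \<Longrightarrow> w t \<in> X"
    have pos: "real (card (restrictions X F)) > 0"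
      using finite_restrictions[OF finite_alphabet F(1,2) shift_patterns] x0
      by (auto simp: card_gt_0_iff restrictions_def)
    have "real (card (restrictions (avoiding \<rho> w T) ?N)) \<le> c ^ card T * real (card (restrictions X ?N))"
      unfolding c_def
    proof (rule card_avoiding[OF N(1,2) TM _ _ w _ q])
      fix t assume t: "t \<in> T"
      have "B (\<rho> + \<kappa>) t \<subseteq> B R t" using ball_mono R TM t by blast
      then show "B (\<rho> + \<kappa>) t \<subseteq> ?N" using t T(1) by (auto simp: nbhd_def)
      show "card (B (\<rho> + \<kappa>) t) \<le> b" using b t TM by blast
    qed (use sep in blast)+
    also have "\<dots> \<le> c ^ card T * (real (card Q) ^ ?j * real (card (restrictions X F)))"
    proof (rule mult_left_mono)
      have "real (card (restrictions X ?N)) \<le> real (card Q ^ ?j * card (restrictions X F))"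
        using card_restrictions_le[OF finite_alphabet N(1,2) shift_patterns N(3)] by (rule of_nat_mono)
      then show "real (card (restrictions X ?N)) \<le> real (card Q) ^ ?j * real (card (restrictions X F))"
        by simp
    qed (use c in auto)
    also have "\<dots> < real (card (restrictions X F))"
      using small pos mult_strict_right_mono[OF small pos] by (simp add: mult.assoc)
    finally show "card (restrictions (avoiding \<rho> w T) ?N) < card (restrictions X F)"
      by simp
  qed
qed

end

section \<open>Endomorphisms of shifts of finite type\<close>

text \<open>Finite type appears as a test on balls of radius \<open>s\<close> instead of a list of
  forbidden patterns; this is the form suited to gluing and to limits.\<close>

locale finite_type_shift = irreducible_shift M B Q X \<kappa>
  for M :: "'m set" and B and Q :: "'q set" and X and \<kappa> +
  fixes s :: nat
  assumes finite_type: "c \<in> patterns Q M \<Longrightarrow> (\<And>m. m \<in> M \<Longrightarrow> \<exists>x\<in>X. x |` B s m = c |` B s m) \<Longrightarrow> c \<in> X"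
begin

text \<open>A ball of radius \<open>s\<close> that misses \<open>A\<close> sees only
  \<open>y\<close>. One that meets \<open>A\<close> lies in the \<open>2 * s\<close>-neighbourhood
  of \<open>A\<close>, where the result coincides with \<open>x\<close> because \<open>x\<close> and
  \<open>y\<close> agree on the collar.\<close>

lemma override_in_shift:
  assumes A: "A \<subseteq> M" and x: "x \<in> X" and y: "y \<in> X"
    and eq: "\<And>m. m \<in> nbhd (2 * s) A - A \<Longrightarrow> x m = y m"
  shows "override_on y x A \<in> X"
proof (rule finite_type)
  have xy: "x \<in> patterns Q M" "y \<in> patterns Q M" using x y shift_patterns by auto
  have "dom (override_on y x A) = M"
    using xy A by (auto simp: patterns_def override_on_def dom_def split: if_splits)
  moreover have "ran (override_on y x A) \<subseteq> ran x \<union> ran y"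
    by (auto simp: ran_def override_on_def split: if_splits)
  ultimately show "override_on y x A \<in> patterns Q M"
    using xy by (auto simp: patterns_def)
next
  fix m assume m: "m \<in> M"
  show "\<exists>z\<in>X. z |` B s m = override_on y x A |` B s m"
  proof (cases "B s m \<inter> A = {}")
    case True
    then show ?thesis
      using y unfolding restrict_map_eq_iff by (intro bexI[of _ y] ballI) (simp_all add: override_on_def disjoint_iff)
  next
    case False
    then have "B s m \<subseteq> nbhd (2 * s) A" using ball_meets_nbhd A m by blast
    then show ?thesis
      using x unfolding restrict_map_eq_iff by (intro bexI[of _ x] ballI) (auto simp: override_on_def intro!: eq)
  qed
qed

lemma limit_in_shift:
  assumes g: "g \<in> patterns Q M"
    and lim: "\<And>V. finite V \<Longrightarrow> V \<subseteq> M \<Longrightarrow> \<exists>x\<in>X. \<forall>m\<in>V. g m = x m"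
  shows "g \<in> X"
proof (rule finite_type[OF g])
  fix m assume m: "m \<in> M"
  then obtain x where "x \<in> X" "\<forall>n\<in>B s m. g n = x n"
    using lim[of "B s m"] finite_ball[OF m] ball_subset[OF m] by blast
  then show "\<exists>x\<in>X. x |` B s m = g |` B s m"
    by (intro bexI[of _ x]) (auto simp: restrict_map_eq_iff)
qed

end

locale shift_endomorphism = finite_type_shift M B Q X \<kappa> s
  for M :: "'m set" and B and Q :: "'q set" and X and \<kappa> s +
  fixes \<Delta> :: "('m \<rightharpoonup> 'q) \<Rightarrow> ('m \<rightharpoonup> 'q)" and r :: nat
  assumes maps_to: "\<Delta> \<in> X \<rightarrow> X"
    and local: "x \<in> X \<Longrightarrow> y \<in> X \<Longrightarrow> m \<in> M \<Longrightarrow> x |` B r m = y |` B r m \<Longrightarrow> \<Delta> x m = \<Delta> y m"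
begin

lemma image_None: "x \<in> X \<Longrightarrow> m \<notin> M \<Longrightarrow> \<Delta> x m = None"
  using funcset_mem[OF maps_to] subsetD[OF shift_patterns] patterns_None by fast

lemma image_eqI:
  assumes "x \<in> X" "y \<in> X" "\<And>m. m \<in> M \<Longrightarrow> \<Delta> x m = \<Delta> y m"
  shows "\<Delta> x = \<Delta> y"
proof
  show "\<Delta> x m = \<Delta> y m" for m using assms image_None by (cases "m \<in> M") auto
qed

text \<open>The image of a compact space under a continuous map is closed. Concretely, a cluster
  point of approximate preimages of \<open>y\<close> lies in \<open>X\<close>, and locality
  transfers the approximation to its image.\<close>

lemma image_closed:
  assumes y: "y \<in> X" and approx: "\<And>V. finite V \<Longrightarrow> V \<subseteq> M \<Longrightarrow> \<exists>x\<in>X. \<forall>m\<in>V. \<Delta> x m = y m"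
  shows "y \<in> \<Delta> ` X"
proof -
  have "\<forall>V\<in>{V. finite V \<and> V \<subseteq> M}. \<exists>x. x \<in> X \<and> (\<forall>m\<in>V. \<Delta> x m = y m)"
    using approx by blast
  then obtain f where "\<forall>V\<in>{V. finite V \<and> V \<subseteq> M}. f V \<in> X \<and> (\<forall>m\<in>V. \<Delta> (f V) m = y m)"
    by (rule bchoice[THEN exE])
  then have f: "\<And>V. finite V \<Longrightarrow> V \<subseteq> M \<Longrightarrow> f V \<in> X"
    "\<And>V m. finite V \<Longrightarrow> V \<subseteq> M \<Longrightarrow> m \<in> V \<Longrightarrow> \<Delta> (f V) m = y m"
    by blast+
  have fQ: "f V m \<in> Some ` Q" if V: "finite V" "V \<subseteq> M" "m \<in> M" for V m
  proof -
    have "f V \<in> patterns Q M" using f(1)[OF V(1,2)] shift_patterns by blast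
    then have "m \<in> dom (f V)" "ran (f V) \<subseteq> Q" using V(3) by (auto simp: patterns_def)
    then show ?thesis by (auto simp: ran_def)
  qed
  have "\<exists>g. (\<forall>m\<in>M. g m \<in> Some ` Q) \<and> (\<forall>V. finite V \<and> V \<subseteq> M \<longrightarrow>
      (\<exists>W. finite W \<and> V \<subseteq> W \<and> W \<subseteq> M \<and> (\<forall>m\<in>V. g m = f W m)))"
    by (rule finite_choice_cluster_point[of M "\<lambda>_. Some ` Q" f, OF finite_imageI[OF finite_alphabet] fQ])
  then obtain g where gQ: "\<forall>m\<in>M. g m \<in> Some ` Q"
    and g: "\<forall>V. finite V \<and> V \<subseteq> M \<longrightarrow> (\<exists>W. finite W \<and> V \<subseteq> W \<and> W \<subseteq> M \<and> (\<forall>m\<in>V. g m = f W m))"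
    by (elim exE conjE) (rule that)
  \<comment> \<open>The cluster point is unconstrained off \<open>M\<close>, hence the
    restriction.\<close>
  define x where "x = g |` M"
  have x: "\<exists>W. finite W \<and> V \<subseteq> W \<and> W \<subseteq> M \<and> (\<forall>m\<in>V. x m = f W m)" if "finite V" "V \<subseteq> M" for V
  proof -
    from g[rule_format, OF conjI[OF that]] obtain W where
      W: "finite W" "V \<subseteq> W" "W \<subseteq> M" "\<forall>m\<in>V. g m = f W m" by blast
    then have "\<forall>m\<in>V. x m = f W m" by (auto simp: x_def)
    with W show ?thesis by blast
  qed
  have "x \<in> X"
  proof (rule limit_in_shift)
    have "dom x = M" using gQ by (auto simp: x_def dom_def restrict_map_def split: if_splits)
    moreover have "ran x \<subseteq> Q"
      using gQ by (force simp: x_def ran_def restrict_map_def split: if_splits)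
    ultimately show "x \<in> patterns Q M" by (simp add: patterns_def)
  next
    fix V assume "finite V" "V \<subseteq> M"
    from x[OF this] obtain W where "finite W" "W \<subseteq> M" "\<forall>m\<in>V. x m = f W m" by blast
    then show "\<exists>x'\<in>X. \<forall>m\<in>V. x m = x' m" using f(1)[of W] by blast
  qed
  moreover have "\<Delta> x = y"
  proof
    fix m
    show "\<Delta> x m = y m"
    proof (cases "m \<in> M")
      case True
      \<comment> \<open>The approximant is taken for a set containing the whole window
        \<open>B r m\<close>; this set contains \<open>m\<close>, so the image of the approximant
        already equals \<open>y\<close> there.\<close>
      have "finite (B r m)" "B r m \<subseteq> M" using True finite_ball ball_subset by auto
      from x[OF this] obtain W where W: "finite W" "B r m \<subseteq> W" "W \<subseteq> M" "\<forall>n\<in>B r m. x n = f W n"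
        by blast
      have "\<Delta> x m = \<Delta> (f W) m"
        using W \<open>x \<in> X\<close> f(1) True by (intro local) (auto simp: restrict_map_eq_iff)
      also have "\<dots> = y m" using f(2)[OF W(1,3)] W(2) ball_self[OF True] by blast
      finally show ?thesis .
    next
      case False
      then show ?thesis using image_None[OF \<open>x \<in> X\<close>] patterns_None[OF subsetD[OF shift_patterns y]] by simp
    qed
  qed
  ultimately show ?thesis by blast
qed

text \<open>
  A configuration can be rid of the patterns \<open>p t\<close> at the points of a separated set, one after
  another, without changing its image under \<open>\<Delta>\<close>.
\<close>

lemma not_surjective:
  assumes X: "X \<noteq> {}"
    and pairs: "\<And>t. t \<in> M \<Longrightarrow> \<exists>p\<in>X. \<exists>p'\<in>X. p \<noteq> p' \<and> \<Delta> p = \<Delta> p' \<and> (\<forall>m\<in>M - B \<rho>\<^sub>0 t. p m = p' m)"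
  shows "\<Delta> ` X \<noteq> X"
proof
  assume surj: "\<Delta> ` X = X"
  \<comment> \<open>The collar of width \<open>2 * s\<close> keeps the exchanged configuration in
    \<open>X\<close>; that of width \<open>2 * r\<close> contains every \<open>r\<close>-window that
    meets the exchanged region.\<close>
  define \<rho> where "\<rho> = \<rho>\<^sub>0 + 2 * max s r"
  have \<rho>: "\<rho>\<^sub>0 + 2 * s \<le> \<rho>" "\<rho>\<^sub>0 + 2 * r \<le> \<rho>" "\<rho>\<^sub>0 \<le> \<rho>" by (auto simp: \<rho>_def)
  have "\<forall>t\<in>M. \<exists>u. fst u \<in> X \<and> snd u \<in> X \<and> fst u \<noteq> snd u \<and> \<Delta> (fst u) = \<Delta> (snd u)
      \<and> (\<forall>m\<in>M - B \<rho>\<^sub>0 t. fst u m = snd u m)"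
    using pairs by fastforce
  then obtain u where u: "\<forall>t\<in>M. fst (u t) \<in> X \<and> snd (u t) \<in> X \<and> fst (u t) \<noteq> snd (u t)
      \<and> \<Delta> (fst (u t)) = \<Delta> (snd (u t)) \<and> (\<forall>m\<in>M - B \<rho>\<^sub>0 t. fst (u t) m = snd (u t) m)"
    by (rule bchoice[THEN exE])
  define p where "p t = fst (u t)" for t
  define p' where "p' t = snd (u t)" for t
  have p: "p t \<in> X" "p' t \<in> X" "p t \<noteq> p' t" "\<Delta> (p t) = \<Delta> (p' t)"
    "\<And>m. m \<in> M \<Longrightarrow> m \<notin> B \<rho>\<^sub>0 t \<Longrightarrow> p t m = p' t m" if "t \<in> M" for t
    using u that by (auto simp: p_def p'_def)
  have nb: "nbhd (2 * k) (B \<rho>\<^sub>0 t) \<subseteq> B \<rho> t" if "t \<in> M" "k = s \<or> k = r" for t k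
  proof -
    have "nbhd (2 * k) (B \<rho>\<^sub>0 t) \<subseteq> B (\<rho>\<^sub>0 + 2 * k) t"
      using ball_triangle that(1) by (auto simp: nbhd_def)
    also have "\<dots> \<subseteq> B \<rho> t" using \<rho> that by (intro ball_mono) auto
    finally show ?thesis .
  qed
  have replace: "\<exists>x'\<in>X. \<Delta> x' = \<Delta> x \<and> x' |` B \<rho> t \<noteq> p t |` B \<rho> t \<and> (\<forall>m. m \<notin> B \<rho> t \<longrightarrow> x' m = x m)"
    if x: "x \<in> X" and t: "t \<in> M" and occ: "x |` B \<rho> t = p t |` B \<rho> t" for x t
  proof -
    let ?A = "B \<rho>\<^sub>0 t"
    let ?x = "override_on x (p' t) ?A"
    have A: "?A \<subseteq> M" "?A \<subseteq> B \<rho> t" "B \<rho> t \<subseteq> M" using ball_subset ball_mono t \<rho> by auto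
    have xp: "x m = p t m" if "m \<in> B \<rho> t" for m
      using occ that unfolding restrict_map_eq_iff by blast
    \<comment> \<open>Around \<open>t\<close> the configuration equals \<open>p t\<close>, which
      differs from \<open>p' t\<close> only in the inner ball, so the exchange there produces
      \<open>p' t\<close> on the whole larger ball.\<close>
    have xp': "?x m = p' t m" if "m \<in> B \<rho> t" for m
      using xp[OF that] p(5)[OF t, of m] A that by (auto simp: override_on_def)
    have xX: "?x \<in> X"
    proof (rule override_in_shift[OF A(1) p(2)[OF t] x])
      fix m assume m: "m \<in> nbhd (2 * s) ?A - ?A"
      then have "m \<in> B \<rho> t" using nb[OF t, of s] by auto
      then show "p' t m = x m" using xp p(5)[OF t, of m] A m by auto
    qed
    have "\<Delta> ?x = \<Delta> x"
    proof (rule image_eqI[OF xX x])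
      fix m assume m: "m \<in> M"
      show "\<Delta> ?x m = \<Delta> x m"
      proof (cases "B r m \<inter> ?A = {}")
        case True
        then show ?thesis
          using xX x m by (intro local) (auto simp: restrict_map_eq_iff override_on_def)
      next
        case False
        then have "B r m \<subseteq> B \<rho> t" using ball_meets_nbhd[OF A(1) m] nb[OF t, of r] by auto
        then have "?x |` B r m = p' t |` B r m" "x |` B r m = p t |` B r m"
          using xp xp' unfolding restrict_map_eq_iff by blast+
        then have "\<Delta> ?x m = \<Delta> (p' t) m" "\<Delta> x m = \<Delta> (p t) m"
          using local[OF xX p(2)[OF t] m] local[OF x p(1)[OF t] m] by blast+
        then show ?thesis using p(4)[OF t] by simp
      qed
    qed
    moreover have "?x |` B \<rho> t \<noteq> p t |` B \<rho> t"
    proof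
      assume e: "?x |` B \<rho> t = p t |` B \<rho> t"
      have "p t m = p' t m" for m
      proof (cases "m \<in> B \<rho> t")
        case True
        then show ?thesis using e xp'[OF True] unfolding restrict_map_eq_iff by auto
      next
        case False
        then have "m \<notin> ?A" using A by blast
        then show ?thesis
          using p(5)[OF t, of m] patterns_None[OF subsetD[OF shift_patterns p(1)[OF t]]]
            patterns_None[OF subsetD[OF shift_patterns p(2)[OF t]]]
          by (cases "m \<in> M") simp_all
      qed
      then show False using p(3)[OF t] by blast
    qed
    moreover have "\<forall>m. m \<notin> B \<rho> t \<longrightarrow> ?x m = x m" using A by (auto simp: override_on_def)
    ultimately show ?thesis using xX by blast
  qed
  \<comment> \<open>The extra \<open>r\<close> in the radius lets the pattern on \<open>?N\<close>
    determine the image on \<open>F\<close>.\<close>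
  obtain F T where F: "finite F" "F \<subseteq> M" and T: "finite T" "T \<subseteq> M"
    and disj: "\<And>t u. t \<in> T \<Longrightarrow> u \<in> T \<Longrightarrow> t \<noteq> u \<Longrightarrow> B \<rho> t \<inter> B \<rho> u = {}"
    and drop: "\<And>w. (\<And>t. t \<in> T \<Longrightarrow> w t \<in> X) \<Longrightarrow>
      card (restrictions (avoiding \<rho> w T) (nbhd (\<rho> + \<kappa> + r) F)) < card (restrictions X F)"
    by (rule entropy_drop[OF X, of \<rho> "\<rho> + \<kappa> + r"]) auto
  let ?Y = "avoiding \<rho> p T" and ?N = "nbhd (\<rho> + \<kappa> + r) F"
  have avoid: "\<exists>x'\<in>?Y. \<Delta> x' = \<Delta> x" if x: "x \<in> X" for x
    using T disj
  proof (induction rule: finite_induct)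
    case empty
    then show ?case using x by (auto simp: avoiding_def)
  next
    case (insert t T)
    have "\<exists>x'\<in>avoiding \<rho> p T. \<Delta> x' = \<Delta> x" by (rule insert.IH) (use insert.prems in auto)
    then obtain x1 where x1: "x1 \<in> avoiding \<rho> p T" "\<Delta> x1 = \<Delta> x" by blast
    show ?case
    proof (cases "x1 |` B \<rho> t = p t |` B \<rho> t")
      case False
      then show ?thesis using x1 by (intro bexI[of _ x1]) (auto simp: avoiding_def)
    next
      case True
      have "x1 \<in> X" "t \<in> M" using x1 insert.prems by (auto simp: avoiding_def)
      from replace[OF this True] obtain x2 where x2: "x2 \<in> X" "\<Delta> x2 = \<Delta> x1"
        "x2 |` B \<rho> t \<noteq> p t |` B \<rho> t" "\<forall>m. m \<notin> B \<rho> t \<longrightarrow> x2 m = x1 m" by blast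
      \<comment> \<open>The balls are disjoint, so the exchange at \<open>t\<close> does not disturb
        the points treated before.\<close>
      have "x2 |` B \<rho> v \<noteq> p v |` B \<rho> v" if v: "v \<in> T" for v
      proof -
        have "B \<rho> t \<inter> B \<rho> v = {}" using insert.prems(2)[of t v] insert.hyps v by auto
        then have "x2 |` B \<rho> v = x1 |` B \<rho> v" using x2(4) by (auto simp: restrict_map_eq_iff)
        then show ?thesis using x1 v by (simp add: avoiding_def)
      qed
      then show ?thesis using x1 x2 by (intro bexI[of _ x2]) (auto simp: avoiding_def)
    qed
  qed
  have N: "finite ?N" "?N \<subseteq> M" using F finite_nbhd nbhd_subset by auto
  \<comment> \<open>One avoiding configuration is picked for each pattern on \<open>?N\<close>. By
    locality its image on \<open>F\<close> does not depend on the choice, so surjectivity of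
    \<open>\<Delta>\<close> yields every pattern on \<open>F\<close>.\<close>
  define e where "e v = (SOME x. x \<in> ?Y \<and> x |` ?N = v)" for v
  have "restrictions X F \<subseteq> (\<lambda>v. \<Delta> (e v) |` F) ` restrictions ?Y ?N"
  proof
    fix v assume "v \<in> restrictions X F"
    then have "v \<in> restrictions (\<Delta> ` X) F" using surj by simp
    then obtain x where x: "x \<in> X" "v = \<Delta> x |` F" by (auto simp: restrictions_def)
    then obtain x' where x': "x' \<in> ?Y" "v = \<Delta> x' |` F" using avoid[OF x(1)] by auto
    have e: "e (x' |` ?N) \<in> ?Y" "e (x' |` ?N) |` ?N = x' |` ?N"
      unfolding e_def using someI[of "\<lambda>x. x \<in> ?Y \<and> x |` ?N = x' |` ?N" x'] x'(1) by auto
    have "\<Delta> (e (x' |` ?N)) m = \<Delta> x' m" if m: "m \<in> F" for m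
    proof (rule local)
      have "B r m \<subseteq> B (\<rho> + \<kappa> + r) m" using m F by (intro ball_mono) auto
      then have "B r m \<subseteq> ?N" using m by (auto simp: nbhd_def)
      then show "e (x' |` ?N) |` B r m = x' |` B r m"
        using e(2) unfolding restrict_map_eq_iff by blast
    qed (use e x' m F in \<open>auto simp: avoiding_def\<close>)
    then have "v = \<Delta> (e (x' |` ?N)) |` F" using x' by (simp add: restrict_map_eq_iff)
    then show "v \<in> (\<lambda>v. \<Delta> (e v) |` F) ` restrictions ?Y ?N"
      using x' by (auto simp: restrictions_def)
  qed
  then have "card (restrictions X F) \<le> card (restrictions ?Y ?N)"
    using finite_restrictions[OF finite_alphabet N avoiding_patterns] by (rule surj_card_le[rotated])
  moreover have "card (restrictions ?Y ?N) < card (restrictions X F)"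
    by (rule drop) (use p T in auto)
  ultimately show False by simp
qed

text \<open>
  The configurations that agree with a fixed \<open>c\<close> away from \<open>F\<close> realise all patterns on \<open>F\<close>, and
  pre-injectivity keeps their images apart.
\<close>

lemma not_pre_injective:
  assumes X: "X \<noteq> {}"
    and orphans: "\<And>t. t \<in> M \<Longrightarrow> \<exists>p\<in>X. \<forall>x\<in>X. \<exists>m\<in>B \<rho> t. \<Delta> x m \<noteq> p m"
  shows "\<not> pre_injective M X \<Delta>"
proof
  assume inj: "pre_injective M X \<Delta>"
  obtain c where c: "c \<in> X" using X by blast
  have "\<forall>t\<in>M. \<exists>p. p \<in> X \<and> (\<forall>x\<in>X. \<exists>m\<in>B \<rho> t. \<Delta> x m \<noteq> p m)" using orphans by blast
  then obtain p where p: "\<forall>t\<in>M. p t \<in> X \<and> (\<forall>x\<in>X. \<exists>m\<in>B \<rho> t. \<Delta> x m \<noteq> p t m)"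
    by (rule bchoice[THEN exE])
  \<comment> \<open>The entropy estimate needs \<open>\<rho> + \<kappa>\<close>. Changes confined to
    the \<open>\<kappa>\<close>-neighbourhood of \<open>F\<close> affect images only within distance
    \<open>\<kappa> + r\<close>.\<close>
  define R where "R = \<rho> + \<kappa> + r"
  obtain F T where F: "finite F" "F \<subseteq> M" and T: "finite T" "T \<subseteq> M"
    and drop: "\<And>w. (\<And>t. t \<in> T \<Longrightarrow> w t \<in> X) \<Longrightarrow>
      card (restrictions (avoiding \<rho> w T) (nbhd R F)) < card (restrictions X F)"
    by (rule entropy_drop[OF X, of \<rho> R]) (auto simp: R_def)
  let ?Y = "avoiding \<rho> p T" and ?N = "nbhd R F" and ?A = "nbhd \<kappa> F"
  have N: "finite ?N" "?N \<subseteq> M" using F finite_nbhd nbhd_subset by auto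
  have A: "finite ?A" "?A \<subseteq> M" "F \<subseteq> ?A" using F finite_nbhd nbhd_subset subset_nbhd by auto
  have image: "\<Delta> x \<in> ?Y" if x: "x \<in> X" for x
  proof -
    have "\<Delta> x |` B \<rho> t \<noteq> p t |` B \<rho> t" if "t \<in> T" for t
      using p x that T unfolding restrict_map_eq_iff by blast
    then show ?thesis using x maps_to by (auto simp: avoiding_def)
  qed
  have glue: "\<exists>z\<in>X. z |` F = x |` F \<and> (\<forall>m. m \<notin> ?A \<longrightarrow> z m = c m)" if x: "x \<in> X" for x
  proof -
    \<comment> \<open>Irreducibility joins \<open>x\<close> on \<open>F\<close> to \<open>c\<close>
      on the collar \<open>?S\<close> only; finite type then permits replacing everything beyond
      \<open>?A\<close> by \<open>c\<close>.\<close>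
    let ?S = "nbhd (2 * s) ?A - ?A"
    have S: "finite ?S" "?S \<subseteq> M" using finite_nbhd[OF A(2,1)] nbhd_subset[OF A(2), of "2 * s"] by auto
    then obtain y where y: "y \<in> X" "y |` F = x |` F" "y |` ?S = c |` ?S"
      using irreducible[OF F S _ x c] by auto
    let ?z = "override_on c y ?A"
    have "?z \<in> X"
    proof (rule override_in_shift[OF A(2) y(1) c])
      show "y m = c m" if "m \<in> ?S" for m using y(3) that unfolding restrict_map_eq_iff by blast
    qed
    moreover have "?z |` F = x |` F"
      using y(2) A(3) by (auto simp: restrict_map_eq_iff override_on_def)
    ultimately show ?thesis by (intro bexI[of _ ?z]) (auto simp: override_on_def)
  qed
  define e where "e v = (SOME z. z \<in> X \<and> z |` F = v \<and> (\<forall>m. m \<notin> ?A \<longrightarrow> z m = c m))" for v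
  have e: "e v \<in> X" "e v |` F = v" "\<And>m. m \<notin> ?A \<Longrightarrow> e v m = c m" if "v \<in> restrictions X F" for v
  proof -
    have "\<exists>z. z \<in> X \<and> z |` F = v \<and> (\<forall>m. m \<notin> ?A \<longrightarrow> z m = c m)"
      using glue that by (auto simp: restrictions_def)
    from someI_ex[OF this] show "e v \<in> X" "e v |` F = v" "\<And>m. m \<notin> ?A \<Longrightarrow> e v m = c m"
      unfolding e_def by blast+
  qed
  have outside: "\<Delta> (e v) m = \<Delta> c m" if v: "v \<in> restrictions X F" and m: "m \<in> M" "m \<notin> ?N" for v m
  proof (rule local[OF e(1)[OF v] c m(1)])
    have "nbhd r ?A \<subseteq> ?N"
      using nbhd_nbhd[OF F(2), of r \<kappa>] nbhd_mono[OF F(2), of "\<kappa> + r" R] by (auto simp: R_def)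
    then have "B r m \<inter> ?A = {}" using ball_nbhd_disjoint[OF A(2) m(1), of r] m(2) by blast
    then show "e v |` B r m = c |` B r m" using e(3)[OF v] by (auto simp: restrict_map_eq_iff)
  qed
  \<comment> \<open>Images equal on \<open>?N\<close> are equal everywhere, since outside
    \<open>?N\<close> both are the image of \<open>c\<close>. The configurations differ in a finite
    set only, so pre-injectivity applies.\<close>
  have "inj_on (\<lambda>v. \<Delta> (e v) |` ?N) (restrictions X F)"
  proof (rule inj_onI)
    fix v v' assume v: "v \<in> restrictions X F" "v' \<in> restrictions X F"
      and eq: "\<Delta> (e v) |` ?N = \<Delta> (e v') |` ?N"
    have "\<Delta> (e v) = \<Delta> (e v')"
    proof (rule image_eqI[OF e(1)[OF v(1)] e(1)[OF v(2)]])
      fix m assume m: "m \<in> M"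
      show "\<Delta> (e v) m = \<Delta> (e v') m"
      proof (cases "m \<in> ?N")
        case True
        then show ?thesis using eq unfolding restrict_map_eq_iff by blast
      next
        case False
        then show ?thesis using outside[OF v(1) m] outside[OF v(2) m] by simp
      qed
    qed
    moreover have "finite {m \<in> M. e v m \<noteq> e v' m}"
    proof (rule finite_subset[OF _ A(1)], rule subsetI)
      fix m assume "m \<in> {m \<in> M. e v m \<noteq> e v' m}"
      then show "m \<in> ?A" using e(3)[OF v(1), of m] e(3)[OF v(2), of m] by (cases "m \<in> ?A") auto
    qed
    ultimately have same: "e v = e v'"
      by (intro inj[unfolded pre_injective_def, rule_format, OF e(1)[OF v(1)] e(1)[OF v(2)]])
    have "v = e v |` F" by (rule e(2)[OF v(1), symmetric])
    also have "\<dots> = e v' |` F" by (simp only: same)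
    also have "\<dots> = v'" by (rule e(2)[OF v(2)])
    finally show "v = v'" .
  qed
  moreover have "(\<lambda>v. \<Delta> (e v) |` ?N) ` restrictions X F \<subseteq> restrictions ?Y ?N"
  proof (rule image_subsetI)
    fix v assume "v \<in> restrictions X F"
    then have "\<Delta> (e v) \<in> ?Y" using image e(1) by simp
    then show "\<Delta> (e v) |` ?N \<in> restrictions ?Y ?N" by (simp add: restrictions_def)
  qed
  ultimately have "card (restrictions X F) \<le> card (restrictions ?Y ?N)"
    using finite_restrictions[OF finite_alphabet N avoiding_patterns] by (rule card_inj_on_le)
  moreover have "card (restrictions ?Y ?N) < card (restrictions X F)"
    by (rule drop) (use p T in auto)
  ultimately show False by simp
qed

end

section \<open>The Cayley graph of a cell space\<close>

context left_homogeneous_space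
begin

lemma group_G: "group G"
  using group_hom group_hom.axioms(1) by blast

lemma act_closed: "g \<in> carrier G \<Longrightarrow> m \<in> M \<Longrightarrow> \<phi> g m \<in> M"
  using element_image by blast

lemma act_one: "m \<in> M \<Longrightarrow> \<phi> \<one> m = m"
  using id_eq_one by (metis restrict_apply')

lemma act_inv:
  assumes "g \<in> carrier G" "m \<in> M"
  shows "\<phi> (inv g) (\<phi> g m) = m" "\<phi> g (\<phi> (inv g) m) = m"
proof -
  interpret group G by (rule group_G)
  show "\<phi> (inv g) (\<phi> g m) = m"
    using composition_rule[of m "inv g" g] assms act_one by simp
  show "\<phi> g (\<phi> (inv g) m) = m"
    using composition_rule[of m g "inv g"] assms act_one by simp
qed

lemma act_inj: "g \<in> carrier G \<Longrightarrow> m \<in> M \<Longrightarrow> n \<in> M \<Longrightarrow> \<phi> g m = \<phi> g n \<Longrightarrow> m = n"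
  using inj_prop by (meson inj_onD)

lemma stabilizer_iff: "g \<in> stabilizer G \<phi> m \<longleftrightarrow> g \<in> carrier G \<and> \<phi> g m = m"
  by (simp add: stabilizer_def)

lemma translate_in_patterns:
  assumes g: "g \<in> carrier G" and x: "x \<in> patterns Q M"
  shows "translate G M \<phi> g x \<in> patterns Q M"
proof -
  have "dom (translate G M \<phi> g x) = M"
    using dom_translate[OF g, of x] x surj_prop[OF g] by (simp add: patterns_def)
  moreover have "ran (translate G M \<phi> g x) \<subseteq> ran x"
    by (auto simp: ran_def translate_def split: if_splits)
  ultimately show ?thesis using x by (auto simp: patterns_def)
qed

lemma translate_act:
  assumes "g \<in> carrier G" "m \<in> M"
  shows "translate G M \<phi> g x (\<phi> g m) = x m"
  using assms act_closed act_inv by (simp add: translate_def)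

lemma semi_occurs_iff:
  assumes H: "H \<subseteq> carrier G" and p: "dom p \<subseteq> M" and c: "dom c = M"
  shows "semi_occurs G M \<phi> H p c \<longleftrightarrow> (\<exists>h\<in>H. \<forall>m\<in>dom p. c (\<phi> h m) = p m)"
proof -
  have "\<phi> h ` dom p \<subseteq> dom c \<and> translate G M \<phi> h p = c |` (\<phi> h ` dom p)
      \<longleftrightarrow> (\<forall>m\<in>dom p. c (\<phi> h m) = p m)" if "h \<in> H" for h
  proof
    have h: "h \<in> carrier G" using that H by blast
    assume l: "\<phi> h ` dom p \<subseteq> dom c \<and> translate G M \<phi> h p = c |` (\<phi> h ` dom p)"
    show "\<forall>m\<in>dom p. c (\<phi> h m) = p m"
    proof
      fix m assume m: "m \<in> dom p"
      then have "p m = (c |` (\<phi> h ` dom p)) (\<phi> h m)"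
        using translate_act[OF h, of m p] l p by auto
      also have "\<dots> = c (\<phi> h m)" using m by simp
      finally show "c (\<phi> h m) = p m" by simp
    qed
  next
    have h: "h \<in> carrier G" using that H by blast
    assume r: "\<forall>m\<in>dom p. c (\<phi> h m) = p m"
    have "translate G M \<phi> h p n = (c |` (\<phi> h ` dom p)) n" for n
    proof (cases "n \<in> \<phi> h ` dom p")
      case True
      then obtain m where m: "m \<in> dom p" "n = \<phi> h m" by blast
      then have "translate G M \<phi> h p n = p m" using translate_act[OF h] p by blast
      also have "\<dots> = (c |` (\<phi> h ` dom p)) n" using r m by auto
      finally show ?thesis .
    next
      case False
      then have "n \<notin> dom (translate G M \<phi> h p)" using dom_translate[OF h p] by simp
      then show ?thesis using False by (simp add: domIff)
    qed
    moreover have "\<phi> h ` dom p \<subseteq> dom c" using p c act_closed[OF h] by auto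
    ultimately show "\<phi> h ` dom p \<subseteq> dom c \<and> translate G M \<phi> h p = c |` (\<phi> h ` dom p)"
      by (auto simp: fun_eq_iff)
  qed
  then show ?thesis unfolding semi_occurs_def by blast
qed

text \<open>An occurrence via \<open>k\<close> in the translate is an occurrence via
  \<open>inv h \<otimes> k\<close> in \<open>c\<close>, and this element lies in
  \<open>H\<close>.\<close>

lemma translate_in_forbidding:
  assumes H: "subgroup H G" and h: "h \<in> H" and F: "F \<subseteq> finite_patterns Q M"
    and c: "c \<in> forbidding G M \<phi> H Q F"
  shows "translate G M \<phi> h c \<in> forbidding G M \<phi> H Q F"
proof -
  interpret group G by (rule group_G)
  have HG: "H \<subseteq> carrier G" using H by (rule subgroup.subset)
  have hG: "h \<in> carrier G" using h HG by blast
  have cp: "c \<in> patterns Q M" using c by (simp add: forbidding_def)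
  have tp: "translate G M \<phi> h c \<in> patterns Q M" by (rule translate_in_patterns[OF hG cp])
  have dom: "dom c = M" "dom (translate G M \<phi> h c) = M" using cp tp by (auto simp: patterns_def)
  have "\<not> semi_occurs G M \<phi> H f (translate G M \<phi> h c)" if f: "f \<in> F" for f
  proof
    have fM: "dom f \<subseteq> M" using f F by (auto simp: finite_patterns_def patterns_def)
    assume "semi_occurs G M \<phi> H f (translate G M \<phi> h c)"
    then obtain k where k: "k \<in> H" "\<forall>m\<in>dom f. translate G M \<phi> h c (\<phi> k m) = f m"
      unfolding semi_occurs_iff[OF HG fM dom(2)] by blast
    have kG: "k \<in> carrier G" using k HG by blast
    have "inv h \<otimes> k \<in> H" using H h k(1) by (simp add: subgroup.m_closed subgroup.m_inv_closed)
    moreover have "c (\<phi> (inv h \<otimes> k) m) = f m" if "m \<in> dom f" for m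
    proof -
      have m: "m \<in> M" using that fM by blast
      then have "c (\<phi> (inv h \<otimes> k) m) = translate G M \<phi> h c (\<phi> k m)"
        using composition_rule[OF m inv_closed[OF hG] kG] act_closed[OF kG m] by (simp add: translate_def)
      then show ?thesis using k(2) that by simp
    qed
    ultimately have "semi_occurs G M \<phi> H f c"
      unfolding semi_occurs_iff[OF HG fM dom(1)] by blast
    then show False using c f by (auto simp: forbidding_def)
  qed
  then show ?thesis using tp by (simp add: forbidding_def)
qed

end

section \<open>The Cayley graph and its balls\<close>

locale cell_space = left_homogeneous_space G M \<phi>
  for G :: "('g, 'z) monoid_scheme" (structure) and M :: "'m set" and \<phi> +
  fixes K :: "('g, 'm) coords" and S :: "'g set set"
  assumes coordinates: "coordinate_system G M \<phi> K"
    and finite_generators: "finite S"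
    and generating: "right_generating_set G M \<phi> K S"
    and symmetric: "symmetric_generators G \<phi> K S"
begin

abbreviation stab :: "'g set" where "stab \<equiv> origin_stabiliser G \<phi> K"

abbreviation edges :: "('m \<times> 'm) set" where "edges \<equiv> cayley_edges G M \<phi> K S"

definition cball :: "nat \<Rightarrow> 'm \<Rightarrow> 'm set" where
  "cball r m = {n. \<exists>l\<le>r. (m, n) \<in> edges ^^ l}"

lemma origin_in: "origin K \<in> M"
  using coordinates by (simp add: coordinate_system_def)

lemma coord: "m \<in> M \<Longrightarrow> coord K m \<in> carrier G" "m \<in> M \<Longrightarrow> \<phi> (coord K m) (origin K) = m"
  using coordinates by (auto simp: coordinate_system_def)

lemma subgroup_stab: "subgroup stab G"
  by (rule stabilizer_subgroup[OF origin_in])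

text \<open>This is the union of the generating cosets. Its closure under left multiplication by the
  stabiliser and under inverses carries the symmetries of the graph.\<close>

definition steps :: "'g set" where
  "steps = {a \<in> carrier G. a <# stab \<in> S}"

lemma steps_mult:
  assumes "k \<in> stab" "a \<in> steps"
  shows "k \<otimes> a \<in> steps"
proof -
  interpret group G by (rule group_G)
  have k: "k \<in> carrier G" and a: "a \<in> carrier G" "a <# stab \<in> S"
    using assms by (auto simp: steps_def stabilizer_iff)
  have "k <# (a <# stab) \<in> S"
    using generating assms(1) a by (simp add: right_generating_set_def)
  moreover have "k <# (a <# stab) = (k \<otimes> a) <# stab"
    using lcos_m_assoc[OF _ k a(1)] subgroup.subset[OF subgroup_stab] by blast
  ultimately show ?thesis using k a by (simp add: steps_def)
qed

lemma steps_inv: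
  assumes "a \<in> steps"
  shows "inv a \<in> steps"
proof -
  interpret group G by (rule group_G)
  have a: "a \<in> carrier G" "a <# stab \<in> S" using assms by (auto simp: steps_def)
  have "inv a <# stab \<in> coset_inverses G \<phi> K S"
    unfolding coset_inverses_def using a(2) lcos_self[OF a(1) subgroup_stab] by blast
  then show ?thesis using symmetric a by (auto simp: symmetric_generators_def steps_def)
qed

text \<open>Edges may be computed from any group element that moves the origin to the given point,
  not just the coordinate: two such elements differ by a stabiliser element, which
  \<open>steps_mult\<close> absorbs. This freedom yields the invariance of the graph under all of
  \<open>G\<close>.\<close>

lemma edge_iff:
  assumes g: "g \<in> carrier G"
  shows "(\<phi> g (origin K), n) \<in> edges \<longleftrightarrow> (\<exists>a\<in>steps. n = \<phi> (g \<otimes> a) (origin K))"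
proof -
  interpret group G by (rule group_G)
  let ?m = "\<phi> g (origin K)"
  have m: "?m \<in> M" using act_closed g origin_in by blast
  have k: "coord K ?m \<in> carrier G" "\<phi> (coord K ?m) (origin K) = ?m" using coord m by auto
  have S: "S = (\<lambda>a. a <# stab) ` steps"
    using generating by (auto simp: right_generating_set_def LCOSETS_def steps_def)
  have edge: "(?m, n) \<in> edges \<longleftrightarrow> (\<exists>a\<in>steps. n = \<phi> (coord K ?m \<otimes> a) (origin K))"
  proof -
    have "(?m, n) \<in> edges \<longleftrightarrow> (\<exists>s\<in>S. n = semi_act G \<phi> K ?m s)"
      using m by (auto simp: cayley_edges_def)
    also have "\<dots> \<longleftrightarrow> (\<exists>a\<in>steps. n = semi_act G \<phi> K ?m (a <# stab))"
      by (subst S) simp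
    also have "\<dots> \<longleftrightarrow> (\<exists>a\<in>steps. n = \<phi> (coord K ?m \<otimes> a) (origin K))"
      by (rule bex_cong[OF refl]) (simp add: semi_act_eq[OF coordinates m] steps_def)
    finally show ?thesis .
  qed
  have shift: "\<exists>b\<in>steps. \<phi> (g1 \<otimes> a) (origin K) = \<phi> (g2 \<otimes> b) (origin K)"
    if g12: "g1 \<in> carrier G" "g2 \<in> carrier G" "\<phi> g1 (origin K) = \<phi> g2 (origin K)"
      and a: "a \<in> steps" for g1 g2 a
  proof
    have aG: "a \<in> carrier G" using a by (simp add: steps_def)
    have "\<phi> (inv g2 \<otimes> g1) (origin K) = \<phi> (inv g2) (\<phi> g2 (origin K))"
      using composition_rule[OF origin_in inv_closed[OF g12(2)] g12(1)] g12(3) by simp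
    also have "\<dots> = origin K" using act_inv[OF g12(2) origin_in] by simp
    finally have "inv g2 \<otimes> g1 \<in> stab" using g12 by (simp add: stabilizer_iff)
    then show "inv g2 \<otimes> g1 \<otimes> a \<in> steps" using steps_mult a by blast
    have "g2 \<otimes> (inv g2 \<otimes> g1 \<otimes> a) = g1 \<otimes> a"
      using g12 aG by (simp add: m_assoc[symmetric])
    then show "\<phi> (g1 \<otimes> a) (origin K) = \<phi> (g2 \<otimes> (inv g2 \<otimes> g1 \<otimes> a)) (origin K)" by simp
  qed
  show ?thesis
    unfolding edge using shift[OF k(1) g k(2)] shift[OF g k(1) k(2)[symmetric]] by fastforce
qed

lemma edges_subset: "edges \<subseteq> M \<times> M"
proof
  fix e assume "e \<in> edges"
  then obtain m n where e: "e = (m, n)" "(m, n) \<in> edges" "m \<in> M"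
    by (auto simp: cayley_edges_def)
  interpret group G by (rule group_G)
  have "(\<phi> (coord K m) (origin K), n) \<in> edges" using e coord by simp
  then obtain a where "a \<in> steps" "n = \<phi> (coord K m \<otimes> a) (origin K)"
    using edge_iff coord e(3) by blast
  then have "n \<in> M" using act_closed[OF m_closed[OF coord(1)[OF e(3)]] origin_in] by (auto simp: steps_def)
  then show "e \<in> M \<times> M" using e by simp
qed

lemma edges_sym:
  assumes "(m, n) \<in> edges"
  shows "(n, m) \<in> edges"
proof -
  interpret group G by (rule group_G)
  have m: "m \<in> M" using assms edges_subset by blast
  let ?g = "coord K m"
  have "(\<phi> ?g (origin K), n) \<in> edges" using assms coord m by simp
  then obtain a where a: "a \<in> steps" "n = \<phi> (?g \<otimes> a) (origin K)"
    using edge_iff coord m by blast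
  have aG: "a \<in> carrier G" using a by (simp add: steps_def)
  have "?g \<otimes> a \<otimes> inv a = ?g" using coord(1)[OF m] aG by (simp add: m_assoc)
  then have "m = \<phi> (?g \<otimes> a \<otimes> inv a) (origin K)" using coord(2)[OF m] by simp
  then show ?thesis
    unfolding a(2) using edge_iff[of "?g \<otimes> a" m] coord(1)[OF m] aG steps_inv[OF a(1)] by auto
qed

lemma edges_act:
  assumes h: "h \<in> carrier G" and e: "(m, n) \<in> edges"
  shows "(\<phi> h m, \<phi> h n) \<in> edges"
proof -
  interpret group G by (rule group_G)
  have m: "m \<in> M" using e edges_subset by blast
  let ?g = "coord K m"
  have g: "?g \<in> carrier G" using coord m by blast
  have "(\<phi> ?g (origin K), n) \<in> edges" using e coord m by simp
  then obtain a where a: "a \<in> steps" "n = \<phi> (?g \<otimes> a) (origin K)"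
    using edge_iff g by blast
  have aG: "a \<in> carrier G" using a by (simp add: steps_def)
  have "\<phi> h n = \<phi> (h \<otimes> ?g \<otimes> a) (origin K)"
    using composition_rule[OF origin_in h m_closed[OF g aG]] a h g aG by (simp add: m_assoc)
  then have "(\<phi> (h \<otimes> ?g) (origin K), \<phi> h n) \<in> edges"
    using edge_iff[of "h \<otimes> ?g"] h g a(1) by blast
  moreover have "\<phi> (h \<otimes> ?g) (origin K) = \<phi> h m"
    using composition_rule[OF origin_in h g] coord(2)[OF m] by simp
  ultimately show ?thesis by simp
qed

lemma relpow_edges_sym: "(m, n) \<in> edges ^^ l \<Longrightarrow> (n, m) \<in> edges ^^ l"
proof (induction l arbitrary: n)
  case (Suc l)
  then obtain k where "(m, k) \<in> edges ^^ l" "(k, n) \<in> edges" by auto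
  then have "(n, k) \<in> edges" "(k, m) \<in> edges ^^ l" using Suc.IH edges_sym by auto
  then show ?case by (rule relpow_Suc_I2)
qed simp

lemma relpow_edges_act:
  "h \<in> carrier G \<Longrightarrow> (m, n) \<in> edges ^^ l \<Longrightarrow> (\<phi> h m, \<phi> h n) \<in> edges ^^ l"
proof (induction l arbitrary: n)
  case (Suc l)
  then obtain k where "(m, k) \<in> edges ^^ l" "(k, n) \<in> edges" by auto
  then have "(\<phi> h m, \<phi> h k) \<in> edges ^^ l" "(\<phi> h k, \<phi> h n) \<in> edges"
    using Suc edges_act by auto
  then show ?case by (rule relpow_Suc_I)
qed simp

lemma relpow_edges_closed: "m \<in> M \<Longrightarrow> (m, n) \<in> edges ^^ l \<Longrightarrow> n \<in> M"
  using edges_subset by (cases l) auto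

lemma cball_act:
  assumes "h \<in> carrier G" "n \<in> cball r m"
  shows "\<phi> h n \<in> cball r (\<phi> h m)"
  using assms relpow_edges_act by (auto simp: cball_def)

lemma finite_cball: "finite (cball r m)"
proof -
  have "finite {n. (m, n) \<in> edges ^^ l}" for l
  proof (induction l)
    case (Suc l)
    have "{n. (m, n) \<in> edges ^^ Suc l}
        \<subseteq> (\<Union>k\<in>{n. (m, n) \<in> edges ^^ l}. (\<lambda>s. semi_act G \<phi> K k s) ` S)"
      by (auto simp: cayley_edges_def)
    then show ?case
      by (rule finite_subset) (use Suc finite_generators in blast)
  qed simp
  moreover have "cball r m = (\<Union>l\<in>{..r}. {n. (m, n) \<in> edges ^^ l})"
    by (auto simp: cball_def)
  ultimately show ?thesis by simp
qed

sublocale coarse_space M cball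
proof
  fix m n l r s
  show "m \<in> M \<Longrightarrow> m \<in> cball r m"
    by (auto simp: cball_def intro!: exI[of _ 0])
  show "m \<in> M \<Longrightarrow> cball r m \<subseteq> M"
    using relpow_edges_closed by (auto simp: cball_def)
  show "m \<in> M \<Longrightarrow> n \<in> cball r m \<Longrightarrow> m \<in> cball r n"
    using relpow_edges_sym by (auto simp: cball_def)
  show "l \<in> cball (r + s) m" if "n \<in> cball r m" "l \<in> cball s n"
  proof -
    obtain i j where "i \<le> r" "j \<le> s" "(m, n) \<in> edges ^^ i" "(n, l) \<in> edges ^^ j"
      using \<open>n \<in> cball r m\<close> \<open>l \<in> cball s n\<close> by (auto simp: cball_def)
    then show ?thesis
      unfolding cball_def by (auto intro!: exI[of _ "i + j"] simp: relpow_add)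
  qed
  \<comment> \<open>Every ball is a translate of the ball around the origin, so one cardinality
    bounds all of them.\<close>
  show "\<exists>b. \<forall>m\<in>M. finite (cball r m) \<and> card (cball r m) \<le> b"
  proof (intro exI ballI conjI)
    fix m assume m: "m \<in> M"
    show "finite (cball r m)" by (rule finite_cball)
    interpret group G by (rule group_G)
    let ?h = "coord K m"
    have "cball r m \<subseteq> \<phi> ?h ` cball r (origin K)"
    proof
      fix n assume n: "n \<in> cball r m"
      have nM: "n \<in> M" using n m relpow_edges_closed by (auto simp: cball_def)
      have "\<phi> (inv ?h) n \<in> cball r (\<phi> (inv ?h) m)" using n coord m by (intro cball_act) auto
      moreover have "\<phi> (inv ?h) m = origin K" using act_inv(1)[OF coord(1)[OF m] origin_in] coord(2)[OF m] by simp
      ultimately show "n \<in> \<phi> ?h ` cball r (origin K)"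
        using act_inv(2)[OF coord(1)[OF m] nM] by (metis imageI)
    qed
    then show "card (cball r m) \<le> card (cball r (origin K))"
      by (rule surj_card_le[OF finite_cball])
  qed
qed

lemma connected:
  assumes m: "m \<in> M"
  shows "\<exists>r. m \<in> cball r (origin K)"
proof -
  obtain ss where ss: "set ss \<subseteq> S \<union> coset_inverses G \<phi> K S" "m = foldl (semi_act G \<phi> K) (origin K) ss"
    using generating m unfolding right_generating_set_def by blast
  then have "set ss \<subseteq> S" using symmetric by (auto simp: symmetric_generators_def)
  then have "(origin K, foldl (semi_act G \<phi> K) (origin K) ss) \<in> edges ^^ length ss"
  proof (induction ss rule: rev_induct)
    case (snoc s ss)
    let ?n = "foldl (semi_act G \<phi> K) (origin K) ss"
    have path: "(origin K, ?n) \<in> edges ^^ length ss" using snoc by simp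
    then have "?n \<in> M" using relpow_edges_closed origin_in by blast
    then have "(?n, semi_act G \<phi> K ?n s) \<in> edges" using snoc.prems by (auto simp: cayley_edges_def)
    then show ?case using path by auto
  qed simp
  then show ?thesis using ss by (auto simp: cball_def)
qed

lemma finite_subset_cball:
  assumes "finite V" "V \<subseteq> M"
  shows "\<exists>r. V \<subseteq> cball r (origin K)"
  using assms
proof induction
  case (insert v V)
  then obtain r where r: "V \<subseteq> cball r (origin K)" by auto
  obtain s where s: "v \<in> cball s (origin K)" using connected[of v] insert.prems by auto
  then have "insert v V \<subseteq> cball (max r s) (origin K)"
    using r s ball_mono[OF origin_in, of r "max r s"] ball_mono[OF origin_in, of s "max r s"] by auto
  then show ?case by blast
qed simp

lemma path_ball_subset: "path_ball G M \<phi> K S r \<subseteq> cball r (origin K)"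
proof
  fix m assume "m \<in> path_ball G M \<phi> K S r"
  \<comment> \<open>A strict bound on an infimum is witnessed by an actual path, hence the passage
    to \<open>Suc r\<close>.\<close>
  then have "path_dist G M \<phi> K S (origin K) m < enat (Suc r)"
    by (auto simp: path_ball_def intro: le_less_trans)
  then obtain l where "(origin K, m) \<in> edges ^^ l" "l < Suc r"
    by (auto simp: path_dist_def INF_less_iff)
  then show "m \<in> cball r (origin K)" by (auto simp: cball_def less_Suc_eq_le)
qed

lemma path_setdist_ge:
  assumes "nbhd \<kappa> A \<inter> A' = {}"
  shows "enat (\<kappa> + 1) \<le> path_setdist G M \<phi> K S A A'"
proof -
  have "\<kappa> + 1 \<le> l" if "a \<in> A" "b \<in> A'" "(a, b) \<in> edges ^^ l" for a b l
  proof (rule ccontr)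
    assume "\<not> \<kappa> + 1 \<le> l"
    then have "b \<in> cball \<kappa> a" using that by (auto simp: cball_def intro!: exI[of _ l])
    then show False using assms that by (auto simp: nbhd_def)
  qed
  then show ?thesis
    unfolding path_setdist_def path_dist_def by (intro INF_greatest) auto
qed

end

section \<open>The Folner condition and equivariance\<close>

lemma additive_sum_Pow:
  fixes \<mu> :: "'a set \<Rightarrow> real"
  assumes add: "additive (Pow M) \<mu>" and "finite I" "\<And>n. n \<in> I \<Longrightarrow> A n \<subseteq> M" "disjoint_family_on A I"
  shows "(\<Sum>n\<in>I. \<mu> (A n)) = \<mu> (\<Union>n\<in>I. A n)"
  using assms(2-4)
proof induction
  case empty
  \<comment> \<open>Additivity on two empty sets forces the empty set to have measure 0.\<close>
  show ?case using additiveD[OF add, of "{}" "{}"] by simp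
next
  case (insert i I)
  have "A i \<inter> (\<Union>n\<in>I. A n) = {}"
    using insert.prems(2) insert.hyps by (auto simp: disjoint_family_on_def)
  moreover have "A i \<subseteq> M" "(\<Union>n\<in>I. A n) \<subseteq> M" using insert.prems(1) by auto
  ultimately have "\<mu> (A i \<union> (\<Union>n\<in>I. A n)) = \<mu> (A i) + \<mu> (\<Union>n\<in>I. A n)"
    using additiveD[OF add] by simp
  moreover have "(\<Sum>n\<in>I. \<mu> (A n)) = \<mu> (\<Union>n\<in>I. A n)"
    using insert.prems by (intro insert.IH) (auto simp: disjoint_family_on_def)
  ultimately show ?case using insert.hyps by simp
qed

context cell_space
begin

text \<open>
  The displacement of a point by at most \<open>R\<close> is the semi-action of one of finitely many cosets, in
  any coordinate system, because the metric is invariant. Hence \<open>\<mu>\<close> is preserved by injections of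
  bounded displacement, and no two of them have disjoint images.
\<close>

lemma right_amenable_not_paradoxical:
  assumes amenable: "right_amenable G M \<phi>"
    and inj: "inj_on f (M \<times> (UNIV :: bool set))"
    and near: "\<And>m i. m \<in> M \<Longrightarrow> f (m, i) \<in> cball R m"
  shows False
proof -
  interpret group G by (rule group_G)
  obtain K' and \<mu> :: "'m set \<Rightarrow> real" where K': "coordinate_system G M \<phi> K'"
    and nonneg: "\<forall>A. A \<subseteq> M \<longrightarrow> 0 \<le> \<mu> A" and total: "\<mu> M = 1" and add: "additive (Pow M) \<mu>"
    and inv: "\<forall>\<gamma> \<in> lcosets (origin_stabiliser G \<phi> K'). \<forall>A. A \<subseteq> M \<longrightarrow>
       inj_on (\<lambda>m. semi_act G \<phi> K' m \<gamma>) A \<longrightarrow> \<mu> ((\<lambda>m. semi_act G \<phi> K' m \<gamma>) ` A) = \<mu> A"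
    using amenable[unfolded right_amenable_def] by (elim exE conjE) (rule that)
  have o': "origin K' \<in> M" using K' by (simp add: coordinate_system_def)
  have g': "coord K' m \<in> carrier G" "\<phi> (coord K' m) (origin K') = m" if "m \<in> M" for m
    using K' that by (auto simp: coordinate_system_def)
  let ?I = "cball R (origin K')"
  have I: "finite ?I" "?I \<subseteq> M" using finite_cball ball_subset o' by auto
  have fM: "f (m, i) \<in> M" if "m \<in> M" for m i using near[OF that] ball_subset[OF that] by blast
  have full: "\<mu> ((\<lambda>m. f (m, i)) ` M) = 1" for i
  proof -
    \<comment> \<open>The sets \<open>A n\<close> partition \<open>M\<close> by displacement, read
      in the coordinates of the invariant mean. On \<open>A n\<close> the map is the semi-action of
      the coset belonging to \<open>n\<close>.\<close>
    define A where "A n = {m \<in> M. f (m, i) = \<phi> (coord K' m) n}" for n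
    have fi: "inj_on (\<lambda>m. f (m, i)) M"
      using inj by (auto simp: inj_on_def)
    have AM: "A n \<subseteq> M" for n by (auto simp: A_def)
    have cover: "(\<Union>n\<in>?I. A n) = M"
    proof
      show "M \<subseteq> (\<Union>n\<in>?I. A n)"
      proof
        fix m assume m: "m \<in> M"
        let ?n = "\<phi> (inv (coord K' m)) (f (m, i))"
        have "?n \<in> cball R (\<phi> (inv (coord K' m)) m)"
          using near[OF m] g'[OF m] by (intro cball_act) auto
        moreover have "\<phi> (inv (coord K' m)) m = origin K'"
          using act_inv(1)[OF g'(1)[OF m] o'] g'(2)[OF m] by simp
        moreover have "m \<in> A ?n"
          using m act_inv(2)[OF g'(1)[OF m] fM[OF m]] by (simp add: A_def)
        ultimately show "m \<in> (\<Union>n\<in>?I. A n)" by auto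
      qed
    qed (use AM in auto)
    have disj: "disjoint_family_on A ?I"
      unfolding disjoint_family_on_def
    proof (intro ballI impI equals0I)
      fix n n' m assume n: "n \<in> ?I" "n' \<in> ?I" "n \<noteq> n'" and "m \<in> A n \<inter> A n'"
      then have m: "m \<in> M" "\<phi> (coord K' m) n = \<phi> (coord K' m) n'" by (auto simp: A_def)
      have "n \<in> M" "n' \<in> M" using n I(2) by auto
      from act_inj[OF g'(1)[OF m(1)] this m(2)] n(3) show False by simp
    qed
    have image: "\<mu> ((\<lambda>m. f (m, i)) ` A n) = \<mu> (A n)" if n: "n \<in> ?I" for n
    proof -
      let ?\<gamma> = "coord K' n <# origin_stabiliser G \<phi> K'"
      have nM: "n \<in> M" using n I by blast
      have eq: "semi_act G \<phi> K' m ?\<gamma> = f (m, i)" if "m \<in> A n" for m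
      proof -
        have m: "m \<in> M" using that AM by blast
        have "semi_act G \<phi> K' m ?\<gamma> = \<phi> (coord K' m \<otimes> coord K' n) (origin K')"
          by (rule semi_act_eq[OF K' m g'(1)[OF nM]])
        also have "\<dots> = \<phi> (coord K' m) n"
          using composition_rule[OF o' g'(1)[OF m] g'(1)[OF nM]] g'(2)[OF nM] by simp
        finally show ?thesis using that by (simp add: A_def)
      qed
      have "(\<lambda>m. semi_act G \<phi> K' m ?\<gamma>) ` A n = (\<lambda>m. f (m, i)) ` A n"
        using eq by (intro image_cong) auto
      moreover have "inj_on (\<lambda>m. semi_act G \<phi> K' m ?\<gamma>) (A n)"
        using inj_on_subset[OF fi AM] eq by (simp add: inj_on_def)
      moreover have "?\<gamma> \<in> lcosets (origin_stabiliser G \<phi> K')"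
        using g'(1)[OF nM] by (auto simp: LCOSETS_def)
      ultimately show ?thesis using inv[rule_format, of ?\<gamma> "A n"] AM by simp
    qed
    have "\<mu> ((\<lambda>m. f (m, i)) ` M) = \<mu> (\<Union>n\<in>?I. (\<lambda>m. f (m, i)) ` A n)"
      by (simp only: image_UN[symmetric] cover)
    also have "\<dots> = (\<Sum>n\<in>?I. \<mu> ((\<lambda>m. f (m, i)) ` A n))"
    proof (rule additive_sum_Pow[symmetric, OF add I(1)])
      show "(\<lambda>m. f (m, i)) ` A n \<subseteq> M" for n using fM AM by blast
      show "disjoint_family_on (\<lambda>n. (\<lambda>m. f (m, i)) ` A n) ?I"
        unfolding disjoint_family_on_def
      proof (intro ballI impI)
        fix n n' assume n: "n \<in> ?I" "n' \<in> ?I" "n \<noteq> n'"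
        have "(\<lambda>m. f (m, i)) ` A n \<inter> (\<lambda>m. f (m, i)) ` A n' = (\<lambda>m. f (m, i)) ` (A n \<inter> A n')"
          by (rule inj_on_image_Int[OF fi AM AM, symmetric])
        also have "A n \<inter> A n' = {}" using disj n by (auto simp: disjoint_family_on_def)
        finally show "(\<lambda>m. f (m, i)) ` A n \<inter> (\<lambda>m. f (m, i)) ` A n' = {}" by simp
      qed
    qed
    also have "\<dots> = (\<Sum>n\<in>?I. \<mu> (A n))" using image by simp
    also have "\<dots> = \<mu> M" using additive_sum_Pow[OF add I(1) AM disj] cover by simp
    finally show ?thesis using total by simp
  qed
  let ?P = "\<lambda>i. (\<lambda>m. f (m, i)) ` M"
  have P: "?P i \<subseteq> M" for i using fM by blast
  have disj: "?P True \<inter> ?P False = {}" using inj by (auto simp: inj_on_def)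
  have "\<mu> (?P True \<union> ?P False) = 2"
    using additiveD[OF add disj] P full by simp
  moreover have "\<mu> (?P True \<union> ?P False) + \<mu> (M - (?P True \<union> ?P False)) = \<mu> M"
    using additiveD[OF add, of "?P True \<union> ?P False" "M - (?P True \<union> ?P False)"] P
    by (simp add: Un_absorb1)
  moreover have "\<mu> (M - (?P True \<union> ?P False)) \<ge> 0" by (rule nonneg[rule_format]) blast
  ultimately show False using total by simp
qed

lemma right_amenable_folner:
  assumes "right_amenable G M \<phi>"
  shows "\<exists>F. finite F \<and> F \<subseteq> M \<and> F \<noteq> {} \<and> n * card (nbhd r F - F) \<le> card F"
  by (rule folner_if_not_paradoxical) (rule right_amenable_not_paradoxical[OF assms])

section \<open>Finite type, irreducibility and locality in terms of balls\<close>

lemma finite_type_radius: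
  assumes H: "subgroup H G" and F: "finite F" "F \<subseteq> finite_patterns Q M"
  shows "\<exists>s. \<forall>c\<in>patterns Q M.
    (\<forall>m\<in>M. \<exists>x\<in>forbidding G M \<phi> H Q F. x |` cball s m = c |` cball s m) \<longrightarrow>
    c \<in> forbidding G M \<phi> H Q F"
proof -
  have HG: "H \<subseteq> carrier G" using H by (rule subgroup.subset)
  have Fdom: "finite (dom f)" "dom f \<subseteq> M" if "f \<in> F" for f
    using that F(2) by (auto simp: finite_patterns_def patterns_def)
  have "finite (\<Union> (dom ` F))" using F(1) Fdom(1) by simp
  moreover have "\<Union> (dom ` F) \<subseteq> M" using Fdom(2) by blast
  \<comment> \<open>An occurrence via \<open>h\<close> of any forbidden pattern then lies in the
    \<open>s\<close>-ball around the translated origin, where \<open>c\<close> agrees with a member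
    of the shift.\<close>
  ultimately obtain s where s: "\<Union> (dom ` F) \<subseteq> cball s (origin K)" using finite_subset_cball by blast
  show ?thesis
  proof (intro exI[of _ s] ballI impI)
    fix c assume c: "c \<in> patterns Q M"
      and loc: "\<forall>m\<in>M. \<exists>x\<in>forbidding G M \<phi> H Q F. x |` cball s m = c |` cball s m"
    have "\<not> semi_occurs G M \<phi> H f c" if f: "f \<in> F" for f
    proof
      assume "semi_occurs G M \<phi> H f c"
      then obtain h where h: "h \<in> H" "\<forall>m\<in>dom f. c (\<phi> h m) = f m"
        using semi_occurs_iff[OF HG Fdom(2)[OF f]] c by (auto simp: patterns_def)
      have hG: "h \<in> carrier G" using h HG by blast
      obtain x where x: "x \<in> forbidding G M \<phi> H Q F"
        "x |` cball s (\<phi> h (origin K)) = c |` cball s (\<phi> h (origin K))"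
        using bspec[OF loc act_closed[OF hG origin_in]] by blast
      have "x (\<phi> h m) = f m" if m: "m \<in> dom f" for m
      proof -
        have "\<phi> h m \<in> cball s (\<phi> h (origin K))" using s f m by (intro cball_act[OF hG]) auto
        then show ?thesis using x(2) h(2) m unfolding restrict_map_eq_iff by auto
      qed
      moreover have "dom x = M" using x(1) by (auto simp: forbidding_def patterns_def)
      ultimately have "semi_occurs G M \<phi> H f x"
        using semi_occurs_iff[OF HG Fdom(2)[OF f]] h(1) by blast
      then show False using x(1) f by (auto simp: forbidding_def)
    qed
    then show "c \<in> forbidding G M \<phi> H Q F" using c by (simp add: forbidding_def)
  qed
qed

text \<open>Restrictions of members of \<open>X\<close> are allowed patterns, as they occur via the
  neutral element, and the disjointness of \<open>nbhd \<kappa> A\<close> from \<open>A'\<close>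
  supplies the required distance.\<close>

lemma irreducibleD:
  assumes H: "subgroup H G" and X: "X \<subseteq> patterns Q M"
    and SI: "strongly_irreducible G M \<phi> K H S Q X"
  shows "\<exists>\<kappa>. \<forall>A A'. finite A \<longrightarrow> A \<subseteq> M \<longrightarrow> finite A' \<longrightarrow> A' \<subseteq> M \<longrightarrow> nbhd \<kappa> A \<inter> A' = {} \<longrightarrow>
      (\<forall>x\<in>X. \<forall>y\<in>X. \<exists>z\<in>X. z |` A = x |` A \<and> z |` A' = y |` A')"
proof -
  obtain \<kappa> :: nat where \<kappa>: "\<forall>p \<in> finite_patterns Q M. \<forall>p' \<in> finite_patterns Q M.
        allowed G M \<phi> H X p \<longrightarrow> allowed G M \<phi> H X p' \<longrightarrow>
        path_setdist G M \<phi> K S (dom p) (dom p') \<ge> enat (\<kappa> + 1) \<longrightarrow>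
        (\<exists>x\<in>X. x |` dom p = p \<and> x |` dom p' = p')"
    using SI[unfolded strongly_irreducible_def] by (elim exE conjE) (rule that)
  have HG: "H \<subseteq> carrier G" using H by (rule subgroup.subset)
  have pat: "x |` A \<in> finite_patterns Q M" "allowed G M \<phi> H X (x |` A)" "dom (x |` A) = A"
    if x: "x \<in> X" and A: "finite A" "A \<subseteq> M" for x A
  proof -
    have d: "dom x = M" using x X by (auto simp: patterns_def)
    then show dA: "dom (x |` A) = A" using A by auto
    show "x |` A \<in> finite_patterns Q M"
      unfolding finite_patterns_def using restrict_in_patterns[of x Q M A] x X A by blast
    have "\<forall>m\<in>dom (x |` A). x (\<phi> \<one> m) = (x |` A) m"
      unfolding dA using A act_one by auto
    then have "semi_occurs G M \<phi> H (x |` A) x"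
      using semi_occurs_iff[OF HG _ d, of "x |` A"] dA A subgroup.one_closed[OF H] by auto
    then show "allowed G M \<phi> H X (x |` A)" using x by (auto simp: allowed_def)
  qed
  show ?thesis
  proof (intro exI[of _ \<kappa>] allI ballI impI)
    fix A A' x y
    assume A: "finite A" "A \<subseteq> M" and A': "finite A'" "A' \<subseteq> M" and disj: "nbhd \<kappa> A \<inter> A' = {}"
      and x: "x \<in> X" and y: "y \<in> X"
    show "\<exists>z\<in>X. z |` A = x |` A \<and> z |` A' = y |` A'"
      using \<kappa>[rule_format, of "x |` A" "y |` A'"] pat[OF x A] pat[OF y A'] path_setdist_ge[OF disj] by simp
  qed
qed

lemma local_map_radius:
  assumes \<Delta>: "local_map G M \<phi> K H S Q X Y \<Delta>"
  shows "\<exists>r. \<forall>x\<in>X. \<forall>y\<in>X. \<forall>m\<in>M. x |` cball r m = y |` cball r m \<longrightarrow> \<Delta> x m = \<Delta> y m"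
proof -
  obtain r N \<delta> where N: "N \<subseteq> path_ball G M \<phi> K S r"
    and eq': "\<forall>x\<in>X. \<forall>m\<in>M. \<Delta> x m = Some (\<delta> ((\<lambda>n. x (semi_act_point G \<phi> K m n)) |` N))"
    using \<Delta>[unfolded local_map_def] by (elim exE conjE) (rule that)
  note eq = eq'[rule_format]
  show ?thesis
  proof (intro exI[of _ r] ballI impI)
    fix x y m assume xy: "x \<in> X" "y \<in> X" and m: "m \<in> M" and agree: "x |` cball r m = y |` cball r m"
    have "x (semi_act_point G \<phi> K m n) = y (semi_act_point G \<phi> K m n)" if n: "n \<in> N" for n
    proof -
      have n': "n \<in> cball r (origin K)" using n N path_ball_subset by blast
      then have "n \<in> M" using ball_subset[OF origin_in] by blast
      then have "semi_act_point G \<phi> K m n = \<phi> (coord K m) n"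
        by (rule semi_act_point_eq[OF coordinates m])
      also have "\<dots> \<in> cball r m"
        using cball_act[OF coord(1)[OF m] n'] coord(2)[OF m] by simp
      finally show ?thesis using agree unfolding restrict_map_eq_iff by blast
    qed
    then have "(\<lambda>n. x (semi_act_point G \<phi> K m n)) |` N = (\<lambda>n. y (semi_act_point G \<phi> K m n)) |` N"
      unfolding restrict_map_eq_iff by blast
    then show "\<Delta> x m = \<Delta> y m" using eq[OF xy(1) m] eq[OF xy(2) m] by simp
  qed
qed

text \<open>Coordinates need not be compatible with translation by \<open>h\<close>, but the
  discrepancy is a stabiliser element. It lies in \<open>H\<close> because \<open>H\<close> is big,
  so the invariance of the local rule absorbs it.\<close>

lemma local_map_translate:
  assumes big: "big_subgroup G M K H" and \<Delta>: "local_map G M \<phi> K H S Q X Y \<Delta>"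
    and X: "X \<subseteq> patterns Q M" and Y: "Y \<subseteq> patterns Q M"
    and inv: "\<And>h x. h \<in> H \<Longrightarrow> x \<in> X \<Longrightarrow> translate G M \<phi> h x \<in> X"
    and h: "h \<in> H" and x: "x \<in> X"
  shows "\<Delta> (translate G M \<phi> h x) = translate G M \<phi> h (\<Delta> x)"
proof
  interpret group G by (rule group_G)
  have H: "subgroup H G" and coordH: "\<And>m. m \<in> M \<Longrightarrow> coord K m \<in> H"
    using big by (auto simp: big_subgroup_def)
  obtain r N \<delta> where N: "N \<subseteq> path_ball G M \<phi> K S r"
    and Ninv: "\<forall>g \<in> stab. \<phi> g ` N \<subseteq> N"
    and \<delta>: "\<forall>k \<in> H \<inter> stab. \<forall>l \<in> restrictions X N. \<delta> (translate G M \<phi> k l) = \<delta> l"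
    and eq': "\<forall>x\<in>X. \<forall>m\<in>M. \<Delta> x m = Some (\<delta> ((\<lambda>n. x (semi_act_point G \<phi> K m n)) |` N))"
    and XY: "\<Delta> \<in> X \<rightarrow> Y"
    using \<Delta>[unfolded local_map_def] by (elim exE conjE) (rule that)
  note eq = eq'[rule_format]
  have NM: "N \<subseteq> M" using N path_ball_subset ball_subset[OF origin_in] by blast
  have hG: "h \<in> carrier G" using h subgroup.mem_carrier[OF H] by blast
  have window: "(\<lambda>n. x (semi_act_point G \<phi> K m n)) |` N = (\<lambda>n. x (\<phi> (coord K m) n)) |` N"
    if "m \<in> M" for x :: "'m \<rightharpoonup> 'b" and m
    using semi_act_point_eq[OF coordinates that] NM unfolding restrict_map_eq_iff by auto
  fix m
  show "\<Delta> (translate G M \<phi> h x) m = translate G M \<phi> h (\<Delta> x) m"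
  proof (cases "m \<in> M")
    case False
    have "\<Delta> (translate G M \<phi> h x) \<in> patterns Q M" using XY Y inv[OF h x] by blast
    then show ?thesis using patterns_None[OF _ False] False by (simp add: translate_def)
  next
    case m: True
    define m' where "m' = \<phi> (inv h) m"
    have m': "m' \<in> M" unfolding m'_def using act_closed hG m by simp
    let ?g = "coord K m" and ?g' = "coord K m'"
    have g: "?g \<in> carrier G" "?g' \<in> carrier G" using coord m m' by auto
    \<comment> \<open>This is the discrepancy between the translated coordinate of \<open>m\<close>
      and the coordinate of \<open>m'\<close>.\<close>
    define k where "k = inv ?g' \<otimes> (inv h \<otimes> ?g)"
    have kG: "k \<in> carrier G" using g hG by (simp add: k_def)
    have kH: "k \<in> H" unfolding k_def
      using H h coordH[OF m] coordH[OF m'] by (simp add: subgroup.m_closed subgroup.m_inv_closed)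
    have "\<phi> (inv h \<otimes> ?g) (origin K) = m'"
      using composition_rule[OF origin_in inv_closed[OF hG] g(1)] coord(2)[OF m] by (simp add: m'_def)
    then have "\<phi> k (origin K) = \<phi> (inv ?g') m'"
      unfolding k_def using composition_rule[OF origin_in inv_closed[OF g(2)], of "inv h \<otimes> ?g"] hG g by simp
    also have "\<dots> = origin K" using act_inv(1)[OF g(2) origin_in] coord(2)[OF m'] by simp
    finally have kstab: "k \<in> stab" using kG by (simp add: stabilizer_iff)
    have ikstab: "inv k \<in> H \<inter> stab"
      using subgroup.m_inv_closed[OF H kH] subgroup.m_inv_closed[OF subgroup_stab kstab] by blast
    have g'k: "?g' \<otimes> k = inv h \<otimes> ?g" using g hG by (simp add: k_def m_assoc[symmetric])
    define l where "l = (\<lambda>n. x (\<phi> ?g' n)) |` N"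
    have "l = translate G M \<phi> (inv ?g') x |` N"
      using NM g by (auto simp: l_def restrict_map_eq_iff translate_def)
    moreover have "translate G M \<phi> (inv ?g') x \<in> X"
      using inv x subgroup.m_inv_closed[OF H coordH[OF m']] by blast
    ultimately have l: "l \<in> restrictions X N" by (auto simp: restrictions_def)
    \<comment> \<open>The window of the translate at \<open>m\<close> is the window \<open>l\<close>
      of \<open>x\<close> at \<open>m'\<close>, turned by \<open>inv k\<close>. The domains match
      since both \<open>k\<close> and \<open>inv k\<close> preserve \<open>N\<close>.\<close>
    have "(\<lambda>n. translate G M \<phi> h x (\<phi> ?g n)) |` N = translate G M \<phi> (inv k) l"
    proof
      fix n
      show "((\<lambda>n. translate G M \<phi> h x (\<phi> ?g n)) |` N) n = translate G M \<phi> (inv k) l n"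
      proof (cases "n \<in> M")
        case False
        then show ?thesis using NM by (auto simp: translate_def restrict_map_def)
      next
        case n: True
        have kn: "\<phi> k n \<in> N \<longleftrightarrow> n \<in> N"
        proof
          assume "\<phi> k n \<in> N"
          then have "\<phi> (inv k) (\<phi> k n) \<in> N" using bspec[OF Ninv, of "inv k"] ikstab by blast
          then show "n \<in> N" using act_inv(1)[OF kG n] by simp
        qed (use bspec[OF Ninv kstab] in blast)
        have "translate G M \<phi> h x (\<phi> ?g n) = x (\<phi> (inv h) (\<phi> ?g n))"
          using act_closed[OF g(1) n] by (simp add: translate_def)
        also have "\<phi> (inv h) (\<phi> ?g n) = \<phi> (?g' \<otimes> k) n"
          unfolding g'k using composition_rule[OF n inv_closed[OF hG] g(1)] by simp
        also have "\<dots> = \<phi> ?g' (\<phi> k n)" by (rule composition_rule[OF n g(2) kG])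
        finally have "translate G M \<phi> h x (\<phi> ?g n) = x (\<phi> ?g' (\<phi> k n))" .
        then show ?thesis
          using n kG kn by (simp add: translate_def l_def restrict_map_def)
      qed
    qed
    then have "\<Delta> (translate G M \<phi> h x) m = Some (\<delta> (translate G M \<phi> (inv k) l))"
      using eq[OF inv[OF h x] m] window[OF m, of "translate G M \<phi> h x"] by simp
    also have "\<dots> = Some (\<delta> l)" using bspec[OF bspec[OF \<delta> ikstab] l] by simp
    also have "\<dots> = \<Delta> x m'" using eq[OF x m'] window[OF m', of x] by (simp add: l_def)
    also have "\<dots> = translate G M \<phi> h (\<Delta> x) m" using m by (simp add: translate_def m'_def)
    finally show ?thesis .
  qed
qed

end

section \<open>The Moore and Myhill properties from the metric results\<close>

theorem corollary4p9:
  fixes G :: "('g, 'z) monoid_scheme" and M :: "'m set" and \<phi> :: "'g \<Rightarrow> 'm \<Rightarrow> 'm"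
    and Q :: "'q set"
    and K :: "('g, 'm) coords" and H :: "'g set" and S :: "'g set set"
    and \<X> :: "('m \<rightharpoonup> 'q) set"
  assumes "left_homogeneous_space G M \<phi>"
    and "right_amenable G M \<phi>"
    and "finitely_right_generated G M \<phi>"
    and "finite_stabilisers G M \<phi>"
    and "finite Q"
    and "coordinate_system G M \<phi> K"
    and "big_subgroup G M K H"
    and "finite S" and "right_generating_set G M \<phi> K S" and "symmetric_generators G \<phi> K S"
    and "subshift_of_finite_type G M \<phi> H Q \<X>"
    and "strongly_irreducible G M \<phi> K H S Q \<X>"
  shows "moore_property G M \<phi> K H S Q \<X> \<and> myhill_property G M \<phi> K H S Q \<X>"
proof -
  interpret left_homogeneous_space G M \<phi> by (rule assms(1))
  interpret cell_space G M \<phi> K S by unfold_locales (use assms in auto)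
  interpret group G by (rule group_G)
  have H: "subgroup H G" and coordH: "\<And>m. m \<in> M \<Longrightarrow> coord K m \<in> H"
    using assms(7) by (auto simp: big_subgroup_def)
  obtain F where F: "finite F" "F \<subseteq> finite_patterns Q M" and \<X>: "\<X> = forbidding G M \<phi> H Q F"
    using assms(11) by (auto simp: subshift_of_finite_type_def)
  have \<X>Q: "\<X> \<subseteq> patterns Q M" by (auto simp: \<X> forbidding_def)
  have inv: "translate G M \<phi> h x \<in> \<X>" if "h \<in> H" "x \<in> \<X>" for h x
    using translate_in_forbidding[OF H _ F(2)] that unfolding \<X> by blast
  obtain s where s: "\<forall>c\<in>patterns Q M.
      (\<forall>m\<in>M. \<exists>x\<in>\<X>. x |` cball s m = c |` cball s m) \<longrightarrow> c \<in> \<X>"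
    using finite_type_radius[OF H F] unfolding \<X>[symmetric] by (rule exE)
  obtain \<kappa> where \<kappa>: "\<forall>A A'. finite A \<longrightarrow> A \<subseteq> M \<longrightarrow> finite A' \<longrightarrow> A' \<subseteq> M \<longrightarrow>
      nbhd \<kappa> A \<inter> A' = {} \<longrightarrow> (\<forall>x\<in>\<X>. \<forall>y\<in>\<X>. \<exists>z\<in>\<X>. z |` A = x |` A \<and> z |` A' = y |` A')"
    using irreducibleD[OF H \<X>Q assms(12)] by (rule exE)
  have endo: "\<exists>r. shift_endomorphism M cball Q \<X> \<kappa> s \<Delta> r"
    if \<Delta>: "local_map G M \<phi> K H S Q \<X> \<X> \<Delta>" for \<Delta>
  proof -
    obtain r where r: "\<forall>x\<in>\<X>. \<forall>y\<in>\<X>. \<forall>m\<in>M. x |` cball r m = y |` cball r m \<longrightarrow> \<Delta> x m = \<Delta> y m"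
      using local_map_radius[OF \<Delta>] by (rule exE)
    have "shift_endomorphism M cball Q \<X> \<kappa> s \<Delta> r"
    proof
      show "finite Q" "\<X> \<subseteq> patterns Q M" by (fact assms(5) \<X>Q)+
      show "\<exists>z\<in>\<X>. z |` A = x |` A \<and> z |` A' = y |` A'"
        if "finite A" "A \<subseteq> M" "finite A'" "A' \<subseteq> M" "nbhd \<kappa> A \<inter> A' = {}" "x \<in> \<X>" "y \<in> \<X>" for A A' x y
        using \<kappa> that by blast
      show "\<exists>F. finite F \<and> F \<subseteq> M \<and> F \<noteq> {} \<and> n * card (nbhd r F - F) \<le> card F" for n r
        by (rule right_amenable_folner[OF assms(2)])
      show "c \<in> \<X>" if "c \<in> patterns Q M"
        "\<And>m. m \<in> M \<Longrightarrow> \<exists>x\<in>\<X>. x |` cball s m = c |` cball s m" for c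
        using s that by simp
      show "\<Delta> \<in> \<X> \<rightarrow> \<X>" using \<Delta> by (simp add: local_map_def)
      show "\<Delta> x m = \<Delta> y m" if "x \<in> \<X>" "y \<in> \<X>" "m \<in> M" "x |` cball r m = y |` cball r m" for x y m
        using r that by blast
    qed
    then show ?thesis by blast
  qed
  have equivariant: "\<Delta> (translate G M \<phi> h x) = translate G M \<phi> h (\<Delta> x)"
    if "local_map G M \<phi> K H S Q \<X> \<X> \<Delta>" "h \<in> H" "x \<in> \<X>" for \<Delta> h x
    by (rule local_map_translate[OF assms(7) that(1) \<X>Q \<X>Q inv that(2,3)])
  have "moore_property G M \<phi> K H S Q \<X>"
    unfolding moore_property_def
  proof (intro allI impI)
    fix \<Delta> assume \<Delta>: "local_map G M \<phi> K H S Q \<X> \<X> \<Delta>" and surj: "\<Delta> ` \<X> = \<X>"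
    from endo[OF \<Delta>] obtain r where "shift_endomorphism M cball Q \<X> \<kappa> s \<Delta> r" by blast
    then interpret e: shift_endomorphism M cball Q \<X> \<kappa> s \<Delta> r .
    show "pre_injective M \<X> \<Delta>"
    proof (rule ccontr)
      assume "\<not> pre_injective M \<X> \<Delta>"
      then obtain x x' where x: "x \<in> \<X>" "x' \<in> \<X>" "finite {m \<in> M. x m \<noteq> x' m}" "\<Delta> x = \<Delta> x'" "x \<noteq> x'"
        by (auto simp: pre_injective_def)
      obtain \<rho> where \<rho>: "{m \<in> M. x m \<noteq> x' m} \<subseteq> cball \<rho> (origin K)"
        using finite_subset_cball[OF x(3)] by blast
      \<comment> \<open>Translation by the coordinate of \<open>t\<close>, which lies in
        \<open>H\<close>, carries the pair from the origin to \<open>t\<close>; equivariance keeps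
        the two images equal.\<close>
      have "\<exists>p\<in>\<X>. \<exists>p'\<in>\<X>. p \<noteq> p' \<and> \<Delta> p = \<Delta> p' \<and> (\<forall>m\<in>M - cball \<rho> t. p m = p' m)" if t: "t \<in> M" for t
      proof -
        let ?h = "coord K t"
        let ?p = "translate G M \<phi> ?h x" and ?p' = "translate G M \<phi> ?h x'"
        have h: "?h \<in> H" "?h \<in> carrier G" using coordH coord t by auto
        obtain d where d: "x d \<noteq> x' d" using x(5) by auto
        then have dM: "d \<in> M"
          using patterns_None[OF subsetD[OF \<X>Q x(1)]] patterns_None[OF subsetD[OF \<X>Q x(2)]] by metis
        have "?p \<noteq> ?p'"
          using translate_act[OF h(2) dM, of x] translate_act[OF h(2) dM, of x'] d by auto
        moreover have "\<Delta> ?p = \<Delta> ?p'" using equivariant[OF \<Delta> h(1)] x by simp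
        moreover have "?p m = ?p' m" if m: "m \<in> M - cball \<rho> t" for m
        proof -
          have mM: "m \<in> M" using m by blast
          let ?n = "\<phi> (inv\<^bsub>G\<^esub> ?h) m"
          have n: "?n \<in> M" "\<phi> ?h ?n = m" using act_closed h(2) mM act_inv(2)[OF h(2) mM] by auto
          have "?n \<notin> cball \<rho> (origin K)"
            using cball_act[OF h(2), of ?n \<rho> "origin K"] n(2) coord(2)[OF t] m by auto
          then have "x ?n = x' ?n" using \<rho> n(1) by blast
          then show ?thesis by (simp add: translate_def)
        qed
        ultimately show ?thesis using inv[OF h(1)] x(1,2) by blast
      qed
      moreover have "\<X> \<noteq> {}" using x by blast
      ultimately show False using e.not_surjective[of \<rho>] surj by simp
    qed
  qed
  moreover have "myhill_property G M \<phi> K H S Q \<X>"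
    unfolding myhill_property_def
  proof (intro allI impI)
    fix \<Delta> assume \<Delta>: "local_map G M \<phi> K H S Q \<X> \<X> \<Delta>" and inj: "pre_injective M \<X> \<Delta>"
    from endo[OF \<Delta>] obtain r where "shift_endomorphism M cball Q \<X> \<kappa> s \<Delta> r" by blast
    then interpret e: shift_endomorphism M cball Q \<X> \<kappa> s \<Delta> r .
    show "\<Delta> ` \<X> = \<X>"
    proof (rule ccontr)
      assume "\<Delta> ` \<X> \<noteq> \<X>"
      then obtain y where y: "y \<in> \<X>" "y \<notin> \<Delta> ` \<X>" using e.maps_to by blast
      \<comment> \<open>The image is closed, so a configuration outside it is separated from it by a
        finite pattern.\<close>
      have "\<exists>V. finite V \<and> V \<subseteq> M \<and> (\<forall>x\<in>\<X>. \<exists>m\<in>V. \<Delta> x m \<noteq> y m)"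
      proof (rule ccontr)
        assume "\<not> ?thesis"
        then have "y \<in> \<Delta> ` \<X>" by (intro e.image_closed[OF y(1)]) auto
        then show False using y(2) by blast
      qed
      then obtain V where V: "finite V" "V \<subseteq> M" "\<forall>x\<in>\<X>. \<exists>m\<in>V. \<Delta> x m \<noteq> y m" by blast
      obtain \<rho> where \<rho>: "V \<subseteq> cball \<rho> (origin K)" using finite_subset_cball[OF V(1,2)] by blast
      have "\<exists>p\<in>\<X>. \<forall>x\<in>\<X>. \<exists>m\<in>cball \<rho> t. \<Delta> x m \<noteq> p m" if t: "t \<in> M" for t
      proof (rule bexI[where x = "translate G M \<phi> (coord K t) y"], rule ballI)
        let ?h = "coord K t"
        have h: "?h \<in> H" "?h \<in> carrier G" "inv\<^bsub>G\<^esub> ?h \<in> H"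
          using coordH coord t subgroup.m_inv_closed[OF H] by auto
        show "translate G M \<phi> ?h y \<in> \<X>" by (rule inv[OF h(1) y(1)])
        fix x assume x: "x \<in> \<X>"
        \<comment> \<open>The orphan property is applied to \<open>x\<close> pulled back to the
          origin, and the mismatch found there is pushed forward to the ball around
          \<open>t\<close>.\<close>
        obtain m where m: "m \<in> V" "\<Delta> (translate G M \<phi> (inv\<^bsub>G\<^esub> ?h) x) m \<noteq> y m"
          using bspec[OF V(3) inv[OF h(3) x]] by blast
        have mM: "m \<in> M" using m V by blast
        have "\<Delta> (translate G M \<phi> (inv\<^bsub>G\<^esub> ?h) x) m = \<Delta> x (\<phi> ?h m)"
          using equivariant[OF \<Delta> h(3) x] mM h(2) by (simp add: translate_def)
        moreover have "translate G M \<phi> ?h y (\<phi> ?h m) = y m" by (rule translate_act[OF h(2) mM])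
        moreover have "\<phi> ?h m \<in> cball \<rho> t"
          using cball_act[OF h(2), of m \<rho> "origin K"] \<rho> m(1) coord(2)[OF t] by auto
        ultimately show "\<exists>m\<in>cball \<rho> t. \<Delta> x m \<noteq> translate G M \<phi> ?h y m"
          using m(2) by (intro bexI[of _ "\<phi> ?h m"]) simp_all
      qed
      moreover have "\<X> \<noteq> {}" using y by blast
      ultimately show False using e.not_pre_injective[of \<rho>] inj by simp
    qed
  qed
  ultimately show ?thesis by blast
qed

end
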